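(* Let $\Omega$ be a compact convex neighborhood of $0\in\mathbb R^m$ and suppose the homogeneous part $\dot x=A(u(t))x$ of the affine system is uniformly hyperbolic. Then the affine system has a unique control set $D$ with nonvoid interior, and $D$ is bounded.
   Context: Affine system: $\dot x(t)=A(u(t))x(t)+Cu(t)+d$, $u(t)\in\Omega$, $A(u)=A+\sum_iu_iB_i$, $C=(c_1,\dots,c_m)$, controls $\mathcal U=\{u\in L^\infty(\mathbb R,\mathbb R^m):u(t)\in\Omega\text{ a.e.}\}$, solutions $\varphi(t,x,u)$; standing assumption: the Lie algebra generated by $Ax+d,B_1x+c_1,\dots,B_mx+c_m$ spans $\mathbb R^n$ everywhere. Control set: nonvoid maximal $D$ such that every $x\in D$ admits $u$ with $\varphi(t,x,u)\in D$ for $t\ge0$ and $D\subset\overline{\mathcal O^+(x)}$ for all $x\in D$ ($\mathcal O^+(x)$ the reachable set from $x$). Uniform hyperbolicity: with $\mathcal U$ in the weak* topology and control flow $\Psi_t(u,x)=(u(t+\cdot),\varphi_{\hom}(t,x,u))$ on $\mathcal U\times\mathbb R^n$ ($\varphi_{\hom}$ solutions of $\dot x=A(u(t))x$), $\mathcal U\times\mathbb R^n$ is the Whitney sum of two $\Psi$-invariant subbundles $\mathcal V^1,\mathcal V^2$ with constants $\alpha>0,K\ge1$ such that $\|\varphi_{\hom}(t,x_1,u)\|\le Ke^{-\alpha t}\|x_1\|$ for $t\ge0$, $(u,x_1)\in\mathcal V^1$, and $\|\varphi_{\hom}(t,x_2,u)\|\le Ke^{\alpha t}\|x_2\|$ for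 $t\le0$, $(u,x_2)\in\mathcal V^2$. *)

theory Defs
  imports "HOL-Analysis.Analysis"
begin

definition Au :: "real^'n^'n \<Rightarrow> ('m::finite \<Rightarrow> real^'n^'n) \<Rightarrow> real^'m \<Rightarrow> real^'n^'n" where
  "Au A B u = A + (\<Sum>i\<in>UNIV. (u $ i) *\<^sub>R B i)"

text \<open>Admissible controls: measurable functions with values in Omega
  (representatives of elements of L-infinity with values a.e. in Omega).\<close>
definition controls :: "(real^'m) set \<Rightarrow> (real \<Rightarrow> real^'m) set" where
  "controls \<Omega> = {u. u \<in> borel_measurable lborel \<and> (\<forall>t. u t \<in> \<Omega>)}"

definition is_sol ::
  "real^'n^'n \<Rightarrow> ('m::finite \<Rightarrow> real^'n^'n) \<Rightarrow> real^'m^'n \<Rightarrow> real^'n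
     \<Rightarrow> (real \<Rightarrow> real^'m) \<Rightarrow> real^'n \<Rightarrow> (real \<Rightarrow> real^'n) \<Rightarrow> bool" where
  "is_sol A B C d u x0 y \<longleftrightarrow> y 0 = x0 \<and>
     (\<forall>t\<ge>0. ((\<lambda>s. Au A B (u s) *v y s + C *v u s + d) has_integral (y t - x0)) {0..t}) \<and>
     (\<forall>t\<le>0. ((\<lambda>s. Au A B (u s) *v y s + C *v u s + d) has_integral (x0 - y t)) {t..0})"

text \<open>The solution phi(t,x,u) (unique for admissible controls).\<close>
definition phi ::
  "real^'n^'n \<Rightarrow> ('m::finite \<Rightarrow> real^'n^'n) \<Rightarrow> real^'m^'n \<Rightarrow> real^'n
     \<Rightarrow> real \<Rightarrow> real^'n \<Rightarrow> (real \<Rightarrow> real^'m) \<Rightarrow> real^'n" where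
  "phi A B C d t x u = (THE y. is_sol A B C d u x y) t"

definition phi_hom ::
  "real^'n^'n \<Rightarrow> ('m::finite \<Rightarrow> real^'n^'n) \<Rightarrow> real \<Rightarrow> real^'n \<Rightarrow> (real \<Rightarrow> real^'m) \<Rightarrow> real^'n" where
  "phi_hom A B t x u = phi A B 0 0 t x u"

definition reach_plus ::
  "real^'n^'n \<Rightarrow> ('m::finite \<Rightarrow> real^'n^'n) \<Rightarrow> real^'m^'n \<Rightarrow> real^'n \<Rightarrow> (real^'m) set
     \<Rightarrow> real^'n \<Rightarrow> (real^'n) set" where
  "reach_plus A B C d \<Omega> x = {phi A B C d t x u | t u. t \<ge> 0 \<and> u \<in> controls \<Omega>}"

definition cs_props ::
  "real^'n^'n \<Rightarrow> ('m::finite \<Rightarrow> real^'n^'n) \<Rightarrow> real^'m^'n \<Rightarrow> real^'n \<Rightarrow> (real^'m) set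
     \<Rightarrow> (real^'n) set \<Rightarrow> bool" where
  "cs_props A B C d \<Omega> D \<longleftrightarrow>
     (\<forall>x\<in>D. \<exists>u\<in>controls \<Omega>. \<forall>t\<ge>0. phi A B C d t x u \<in> D) \<and>
     (\<forall>x\<in>D. D \<subseteq> closure (reach_plus A B C d \<Omega> x))"

definition control_set ::
  "real^'n^'n \<Rightarrow> ('m::finite \<Rightarrow> real^'n^'n) \<Rightarrow> real^'m^'n \<Rightarrow> real^'n \<Rightarrow> (real^'m) set
     \<Rightarrow> (real^'n) set \<Rightarrow> bool" where
  "control_set A B C d \<Omega> D \<longleftrightarrow> D \<noteq> {} \<and> cs_props A B C d \<Omega> D \<and>
     (\<forall>D'. D \<subseteq> D' \<and> cs_props A B C d \<Omega> D' \<longrightarrow> D' = D)"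

text \<open>Lie algebra generated by the affine vector fields x \<mapsto> M x + v, represented by
  pairs (M, v); bracket of (M,v),(N,w) is the field of [f,g] = Dg f - Df g.\<close>
definition affine_bracket ::
  "((real^'n^'n) \<times> (real^'n)) \<Rightarrow> ((real^'n^'n) \<times> (real^'n)) \<Rightarrow> ((real^'n^'n) \<times> (real^'n))" where
  "affine_bracket f g = (fst g ** fst f - fst f ** fst g,
                         fst g *v snd f - fst f *v snd g)"

inductive_set lie_gen :: "((real^'n^'n) \<times> (real^'n)) set \<Rightarrow> ((real^'n^'n) \<times> (real^'n)) set"
  for G where
    gen: "f \<in> G \<Longrightarrow> f \<in> lie_gen G"
  | add: "f \<in> lie_gen G \<Longrightarrow> g \<in> lie_gen G \<Longrightarrow> f + g \<in> lie_gen G"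
  | scale: "f \<in> lie_gen G \<Longrightarrow> (c::real) *\<^sub>R f \<in> lie_gen G"
  | bracket: "f \<in> lie_gen G \<Longrightarrow> g \<in> lie_gen G \<Longrightarrow> affine_bracket f g \<in> lie_gen G"

definition lie_rank_condition ::
  "real^'n^'n \<Rightarrow> ('m::finite \<Rightarrow> real^'n^'n) \<Rightarrow> real^'m^'n \<Rightarrow> real^'n \<Rightarrow> bool" where
  "lie_rank_condition A B C d \<longleftrightarrow>
     (\<forall>x. span {fst f *v x + snd f | f. f \<in> lie_gen (insert (A, d) {(B i, column i C) | i. True})}
          = UNIV)"

text \<open>Weak-* convergence of controls (as elements of L^infinity = dual of L^1).
  U is weak-* compact and metrizable, so closedness may be tested with sequences.\<close>
definition weak_star_conv :: "(nat \<Rightarrow> real \<Rightarrow> real^'m) \<Rightarrow> (real \<Rightarrow> real^'m) \<Rightarrow> bool" where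
  "weak_star_conv us u \<longleftrightarrow>
     (\<forall>g::real \<Rightarrow> real^'m. integrable lborel g \<longrightarrow>
        (\<lambda>k. LINT t|lborel. us k t \<bullet> g t) \<longlonglongrightarrow> (LINT t|lborel. u t \<bullet> g t))"

definition fiber :: "((real \<Rightarrow> real^'m) \<times> (real^'n)) set \<Rightarrow> (real \<Rightarrow> real^'m) \<Rightarrow> (real^'n) set" where
  "fiber V u = {x. (u, x) \<in> V}"

definition subbundle :: "(real^'m) set \<Rightarrow> ((real \<Rightarrow> real^'m) \<times> (real^'n)) set \<Rightarrow> bool" where
  "subbundle \<Omega> V \<longleftrightarrow> V \<subseteq> controls \<Omega> \<times> UNIV \<and>
     (\<forall>u\<in>controls \<Omega>. subspace (fiber V u)) \<and>
     (\<forall>u\<in>controls \<Omega>. \<forall>u'\<in>controls \<Omega>. dim (fiber V u) = dim (fiber V u')) \<and>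
     (\<forall>us xs u x. (\<forall>k. (us k, xs k) \<in> V) \<and> u \<in> controls \<Omega> \<and> weak_star_conv us u \<and>
        xs \<longlonglongrightarrow> x \<longrightarrow> (u, x) \<in> V)"

definition flow_invariant ::
  "real^'n^'n \<Rightarrow> ('m::finite \<Rightarrow> real^'n^'n) \<Rightarrow> ((real \<Rightarrow> real^'m) \<times> (real^'n)) set \<Rightarrow> bool" where
  "flow_invariant A B V \<longleftrightarrow>
     (\<forall>t. (\<lambda>(u, x). ((\<lambda>s. u (t + s)), phi_hom A B t x u)) ` V = V)"

definition uniformly_hyperbolic ::
  "real^'n^'n \<Rightarrow> ('m::finite \<Rightarrow> real^'n^'n) \<Rightarrow> (real^'m) set \<Rightarrow> bool" where
  "uniformly_hyperbolic A B \<Omega> \<longleftrightarrow>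
     (\<exists>V1 V2 (\<alpha>::real) (K::real). \<alpha> > 0 \<and> K \<ge> 1 \<and>
        subbundle \<Omega> V1 \<and> subbundle \<Omega> V2 \<and>
        flow_invariant A B V1 \<and> flow_invariant A B V2 \<and>
        (\<forall>u\<in>controls \<Omega>. fiber V1 u \<inter> fiber V2 u = {0} \<and>
            {x1 + x2 | x1 x2. x1 \<in> fiber V1 u \<and> x2 \<in> fiber V2 u} = UNIV) \<and>
        (\<forall>(u, x1)\<in>V1. \<forall>t\<ge>0. norm (phi_hom A B t x1 u) \<le> K * exp (- \<alpha> * t) * norm x1) \<and>
        (\<forall>(u, x2)\<in>V2. \<forall>t\<le>0. norm (phi_hom A B t x2 u) \<le> K * exp (\<alpha> * t) * norm x2))"

end

theory Submission
  imports Defs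
begin

text \<open>
  Hyperbolicity gives, for every control \<open>u\<close>, a solution \<open>e u\<close> bounded on the whole time axis, with a
  bound independent of \<open>u\<close>; moreover two solutions for the same control that are bounded at the ends
  of a long time window are exponentially close in its middle.

  The Lie algebra rank condition yields a piecewise constant control \<open>v\<close> on some \<open>[0, \<tau>]\<close> whose endpoint
  map has, from every initial point, a surjective derivative with respect to the switching times: the
  relevant derivatives are affine vector fields transported along the flow, and these do not depend on
  the initial point. The \<open>\<tau>\<close>-periodic extension \<open>w\<close> of \<open>v\<close> has the periodic point \<open>r = e w\<close>, and by Brouwer's
  theorem all points of a ball around \<open>r\<close> can be steered into each other. Hence \<open>r\<close> lies in the interior
  of a control set \<open>D\<close>. Points on trajectories from \<open>r\<close> to \<open>r\<close> lie on bounded solutions, so \<open>D\<close> is bounded.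

  In a control set with nonvoid interior one can return to an interior point after arbitrarily long
  times. Continuing such a trajectory with the control \<open>w\<close> in the future, respectively in the past, and
  passing to the bounded solution of the combined control connects it with \<open>r\<close>, respectively \<open>r\<close> with
  it; so the control set equals \<open>D\<close>.
\<close>

section \<open>Linear differential equations with bounded measurable coefficients\<close>

text \<open>The control \<open>w\<close> determines \<open>r\<close>, so regularity cannot be
  arranged at \<open>r\<close> once \<open>r\<close> is known: the arcs must be regular from every
  initial point at once. Affine fields allow this because their transport is again an affine field;
  only the weights of the switching times depend on the point.

  A control set is only approximately controllable, and the orbits inside an arbitrary one are not
  known to be bounded. Hence the estimates use norms at the two ends of a window and never in
  between, with constants uniform over all controls: the growth rate comes from compactness of
  \<open>\<Omega>\<close>, the bound on the projections from playing this growth against the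
  exponential separation.

  The bounded solution is built in discrete time, because the projections are merely chosen control
  by control, with no measurability in time. The step length is \<open>\<tau>\<close>, so that
  invariance of \<open>w\<close> under the shift by \<open>\<tau>\<close> makes \<open>e w\<close>
  periodic. Controls are only measurable, so solutions are treated through integral equations; they
  are differentiated only along constant controls.\<close>

lemma gronwall_doubling:
  fixes g :: "real \<Rightarrow> real"
  assumes T: "0 \<le> T" and cont: "continuous_on {0..T} g"
    and bnd: "\<And>t. t \<in> {0..T} \<Longrightarrow> g t \<le> c + L * integral {0..t} g"
    and L: "L > 0" and c: "c \<ge> 0" and nonneg: "\<And>t. t \<in> {0..T} \<Longrightarrow> g t \<ge> 0"
  shows "g T \<le> 2 * c * exp (2 * L * T)"
proof -
  \<comment> \<open>The inequality is used only at the maximum of the weighted function. Its rate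
    \<open>2 * L\<close> is twice the sharp one, so that integration produces the factor 1/2 with
    which the term at the maximum is absorbed; the price is the constant 2.\<close>
  define h where "h t = exp (- (2 * L * t)) * g t" for t
  have "continuous_on {0..T} h"
    unfolding h_def by (intro continuous_intros cont)
  then obtain p where p: "p \<in> {0..T}" "\<And>t. t \<in> {0..T} \<Longrightarrow> h t \<le> h p"
    using continuous_attains_sup[of "{0..T}" h] T by auto
  have g: "g t = h t * exp (2 * L * t)" for t
    unfolding h_def by (simp add: exp_minus field_simps)
  have le: "g t \<le> h p * exp (2 * L * t)" if "t \<in> {0..T}" for t
    using p(2)[OF that] by (simp add: g)
  have I: "((\<lambda>t. h p * exp (2 * L * t)) has_integral (h p * exp (2 * L * p) / (2 * L) - h p * exp (2 * L * 0) / (2 * L))) {0..p}"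
    by (rule fundamental_theorem_of_calculus)
      (use p L in \<open>auto intro!: derivative_eq_intros simp flip: has_real_derivative_iff_has_vector_derivative\<close>)
  have "integral {0..p} g \<le> h p * exp (2 * L * p) / (2 * L) - h p / (2 * L)"
  proof -
    have "continuous_on {0..p} g"
      using p by (intro continuous_on_subset[OF cont]) auto
    then have "integral {0..p} g \<le> integral {0..p} (\<lambda>t. h p * exp (2 * L * t))"
      using p by (intro integral_le le integrable_continuous_interval has_integral_integrable[OF I]) auto
    also have "\<dots> = h p * exp (2 * L * p) / (2 * L) - h p / (2 * L)"
      by (subst integral_unique[OF I]) simp
    finally show ?thesis .
  qed
  then have "L * integral {0..p} g \<le> L * (h p * exp (2 * L * p) / (2 * L) - h p / (2 * L))"
    using L by (intro mult_left_mono) auto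
  also have "\<dots> = h p * exp (2 * L * p) / 2 - h p / 2"
    using L by (simp add: field_simps)
  finally have "g p \<le> c + h p * exp (2 * L * p) / 2 - h p / 2"
    using bnd[OF p(1)] by linarith
  moreover have hp0: "h p \<ge> 0"
    using nonneg[OF p(1)] by (simp add: h_def)
  ultimately have "h p * exp (2 * L * p) \<le> 2 * c"
    using g[of p] by linarith
  moreover have "h p * 1 \<le> h p * exp (2 * L * p)"
    using hp0 L p by (intro mult_left_mono) auto
  ultimately have "h p \<le> 2 * c" by linarith
  moreover have "T \<in> {0..T}" using T by simp
  ultimately show ?thesis
    using le[of T] mult_right_mono[of "h p" "2 * c" "exp (2 * L * T)"] by (meson exp_ge_zero order_trans)
qed

lemma linear_growth_forward:
  fixes y G :: "real \<Rightarrow> 'a::euclidean_space"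
  assumes T: "0 \<le> T" and cont: "continuous_on {0..T} y"
    and int: "\<And>t. t \<in> {0..T} \<Longrightarrow> (G has_integral (y t - y 0)) {0..t}"
    and G: "\<And>s. s \<in> {0..T} \<Longrightarrow> norm (G s) \<le> L * norm (y s) + F"
    and L: "L > 0" and F: "F \<ge> 0"
  shows "norm (y T) \<le> 2 * (norm (y 0) + F * T) * exp (2 * L * T)"
proof (rule gronwall_doubling[where g = "\<lambda>t. norm (y t)"])
  fix t assume t: "t \<in> {0..T}"
  have c: "continuous_on {0..t} (\<lambda>s. norm (y s))"
    using t by (intro continuous_intros continuous_on_subset[OF cont]) auto
  have "norm (y t - y 0) \<le> integral {0..t} (\<lambda>s. L * norm (y s) + F)"
  proof -
    have "norm (integral {0..t} G) \<le> integral {0..t} (\<lambda>s. L * norm (y s) + F)"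
    proof (rule integral_norm_bound_integral)
      show "G integrable_on {0..t}" using int[OF t] by (rule has_integral_integrable)
      show "(\<lambda>s. L * norm (y s) + F) integrable_on {0..t}"
        by (intro integrable_continuous_interval continuous_intros c)
    qed (use t G in auto)
    then show ?thesis by (simp add: integral_unique[OF int[OF t]])
  qed
  also have "\<dots> = L * integral {0..t} (\<lambda>s. norm (y s)) + F * t"
    using t c by (subst integral_add)
      (auto intro!: integrable_continuous_interval continuous_intros)
  also have "\<dots> \<le> L * integral {0..t} (\<lambda>s. norm (y s)) + F * T"
    using t F by (auto intro: mult_left_mono)
  finally show "norm (y t) \<le> norm (y 0) + F * T + L * integral {0..t} (\<lambda>s. norm (y s))"
    using norm_triangle_ineq2[of "y t" "y 0"] by linarith
qed (use T L F in \<open>auto intro!: continuous_intros cont\<close>)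

lemma linear_growth_backward:
  fixes y G :: "real \<Rightarrow> 'a::euclidean_space"
  assumes T: "T \<le> 0" and cont: "continuous_on {T..0} y"
    and int: "\<And>t. t \<in> {T..0} \<Longrightarrow> (G has_integral (y 0 - y t)) {t..0}"
    and G: "\<And>s. s \<in> {T..0} \<Longrightarrow> norm (G s) \<le> L * norm (y s) + F"
    and L: "L > 0" and F: "F \<ge> 0"
  shows "norm (y T) \<le> 2 * (norm (y 0) + F * \<bar>T\<bar>) * exp (2 * L * \<bar>T\<bar>)"
proof -
  have "norm (y (- (- T))) \<le> 2 * (norm (y (- 0)) + F * (- T)) * exp (2 * L * (- T))"
  proof (rule linear_growth_forward[where y = "\<lambda>s. y (- s)" and G = "\<lambda>s. - G (- s)"])
    show "continuous_on {0..- T} (\<lambda>s. y (- s))"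
      by (rule continuous_on_compose2[OF cont]) (auto intro!: continuous_intros)
    fix t assume t: "t \<in> {0..- T}"
    have "(G has_integral (y 0 - y (- t))) {- t..- 0}"
      using int[of "- t"] t by auto
    then have "((\<lambda>s. G (- s)) has_integral (y 0 - y (- t))) {0..t}"
      using has_integral_reflect_real[where f = G and b = 0 and a = "- t"] by simp
    from has_integral_neg[OF this]
    show "((\<lambda>s. - G (- s)) has_integral (y (- t) - y (- 0))) {0..t}" by simp
  qed (use T G L F in auto)
  then show ?thesis using T by simp
qed

text \<open>The difference of the two integrals is the integral from 0 with orientation: one of the
  two intervals is always empty or a point. One formula thus serves both time directions.\<close>

lemma oriented_integral_combine:
  fixes G :: "real \<Rightarrow> 'a::euclidean_space"
  assumes G: "\<And>a b. G integrable_on {a..b}" and ab: "a \<le> b"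
  shows "(G has_integral ((integral {0..b} G - integral {b..0} G) - (integral {0..a} G - integral {a..0} G))) {a..b}"
proof -
  have z: "integral {s..0} G = 0" if "0 \<le> s" for s
    using that by (cases "s = 0") auto
  have z': "integral {0..s} G = 0" if "s \<le> 0" for s
    using that by (cases "s = 0") auto
  have comb: "integral {a..c} G + integral {c..b} G = integral {a..b} G" if "a \<le> c" "c \<le> b" for a b c
    using that G by (intro Henstock_Kurzweil_Integration.integral_combine) auto
  have "(integral {0..b} G - integral {b..0} G) - (integral {0..a} G - integral {a..0} G) = integral {a..b} G"
  proof (cases "0 \<le> a")
    case True
    then show ?thesis using comb[of 0 a b] ab z by (simp add: algebra_simps)
  next
    case False
    show ?thesis
    proof (cases "0 \<le> b")
      case True
      then show ?thesis using comb[of a 0 b] False z z' by (simp add: algebra_simps)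
    next
      case b: False
      then show ?thesis using comb[of a b 0] False z z' ab by (simp add: algebra_simps)
    qed
  qed
  then show ?thesis
    using G by (simp add: has_integral_integral[symmetric])
qed

lemma oriented_integral_exp_bound:
  fixes G :: "real \<Rightarrow> 'a::euclidean_space"
  assumes G: "\<And>a b. G integrable_on {a..b}"
    and bnd: "\<And>s. norm (G s) \<le> c * exp (\<beta> * \<bar>s\<bar>)" and \<beta>: "\<beta> > 0"
  shows "norm (integral {0..t} G - integral {t..0} G) \<le> c / \<beta> * exp (\<beta> * \<bar>t\<bar>)"
proof -
  have c: "c \<ge> 0"
    using order_trans[OF norm_ge_zero bnd[of 0]] by simp
  have *: "norm (integral {0..t} G) \<le> c / \<beta> * exp (\<beta> * t)"
    if t: "0 \<le> t" and G: "G integrable_on {0..t}" and bnd: "\<And>s. norm (G s) \<le> c * exp (\<beta> * \<bar>s\<bar>)" for t and G :: "real \<Rightarrow> 'a"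
  proof -
    have I: "((\<lambda>s. c * exp (\<beta> * s)) has_integral (c * exp (\<beta> * t) / \<beta> - c * exp (\<beta> * 0) / \<beta>)) {0..t}"
      by (rule fundamental_theorem_of_calculus)
        (use t \<beta> in \<open>auto intro!: derivative_eq_intros simp flip: has_real_derivative_iff_has_vector_derivative\<close>)
    have "norm (integral {0..t} G) \<le> integral {0..t} (\<lambda>s. c * exp (\<beta> * s))"
    proof (rule integral_norm_bound_integral[OF G has_integral_integrable[OF I]])
      fix x assume "x \<in> {0..t}"
      then show "norm (G x) \<le> c * exp (\<beta> * x)" using bnd[of x] by simp
    qed
    also have "\<dots> \<le> c / \<beta> * exp (\<beta> * t)"
      using c \<beta> by (subst integral_unique[OF I]) simp
    finally show ?thesis .
  qed
  show ?thesis
  proof (cases "0 \<le> t")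
    case True
    then have "integral {t..0} G = 0" by (cases "t = 0") auto
    then show ?thesis using *[OF True G bnd] True by simp
  next
    case False
    have r: "integral {t..0} G = integral {0..- t} (\<lambda>s. G (- s))"
      using Henstock_Kurzweil_Integration.integral_reflect_real[where f = G and b = 0 and a = t] by simp
    have "(\<lambda>s. G (- s)) integrable_on {0..- t}"
      using G[of t 0] Henstock_Kurzweil_Integration.integrable_reflect_real[where f = G and b = 0 and a = t] by simp
    moreover have "norm (G (- s)) \<le> c * exp (\<beta> * \<bar>s\<bar>)" for s
      using bnd[of "- s"] by simp
    ultimately have "norm (integral {t..0} G) \<le> c / \<beta> * exp (\<beta> * (- t))"
      unfolding r using False by (intro *) auto
    then show ?thesis using False by simp
  qed
qed

text \<open>Picard iteration in a weighted sup norm: the unknown is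
  \<open>exp (- \<beta> * |t|) *\<^sub>R y t\<close>, a bounded continuous function. With the weight
  the operator contracts on the whole time axis, so a single fixed point is a global solution. The
  hypothesis \<open>int\<close> separates the question of measurability from the iteration.\<close>

lemma linear_ode_exists:
  fixes M :: "real \<Rightarrow> 'a::euclidean_space \<Rightarrow> 'a" and f :: "real \<Rightarrow> 'a"
  assumes lin: "\<And>s. linear (M s)" and Mb: "\<And>s z. norm (M s z) \<le> L * norm z"
    and fb: "\<And>s. norm (f s) \<le> F" and L: "L > 0"
    and int: "\<And>y a b. continuous_on UNIV y \<Longrightarrow> (\<lambda>s. M s (y s) + f s) integrable_on {a..b}"
  shows "\<exists>y. y 0 = x0 \<and> continuous_on UNIV y \<and>
    (\<forall>a b. a \<le> b \<longrightarrow> ((\<lambda>s. M s (y s) + f s) has_integral (y b - y a)) {a..b})"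
proof -
  \<comment> \<open>The contraction factor is \<open>L / \<beta>\<close>, which becomes 1/2.\<close>
  define \<beta> where "\<beta> = 2 * L"
  have \<beta>: "\<beta> > 0" using L by (simp add: \<beta>_def)
  have F: "F \<ge> 0" using order_trans[OF norm_ge_zero fb[of 0]] .
  define g where "g z s = M s (exp (\<beta> * \<bar>s\<bar>) *\<^sub>R apply_bcontfun z s) + f s" for z :: "real \<Rightarrow>\<^sub>C 'a" and s
  have gint: "g z integrable_on {a..b}" for z a b
    unfolding g_def
    by (intro int continuous_intros continuous_on_compose2[OF continuous_on_apply_bcontfun]) auto
  define I where "I z t = integral {0..t} (g z) - integral {t..0} (g z)" for z t
  have I: "(g z has_integral (I z b - I z a)) {a..b}" if "a \<le> b" for a b z
    unfolding I_def by (rule oriented_integral_combine[OF gint that])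
  have contI: "continuous_on UNIV (I z)" for z
  proof -
    have "isCont (I z) t" for t
    proof -
      have "continuous_on {t-1..t+1} (\<lambda>s. I z (t-1) + integral {t-1..s} (g z))"
        by (intro continuous_intros indefinite_integral_continuous_1 gint)
      then have "continuous_on {t-1..t+1} (I z)"
      proof (rule continuous_on_eq)
        fix s assume "s \<in> {t-1..t+1}"
        then show "I z (t-1) + integral {t-1..s} (g z) = I z s"
          using integral_unique[OF I[of "t-1" s z]] by simp
      qed
      then show ?thesis
        by (rule continuous_on_interior) auto
    qed
    then show ?thesis by (simp add: continuous_at_imp_continuous_on)
  qed
  have gb: "norm (g z s) \<le> (L * norm z + F) * exp (\<beta> * \<bar>s\<bar>)" for z s
  proof -
    have "norm (g z s) \<le> L * (exp (\<beta> * \<bar>s\<bar>) * norm z) + F"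
      unfolding g_def
      by (rule norm_triangle_le, rule add_mono[OF order_trans[OF Mb] fb])
        (use L in \<open>auto intro!: mult_left_mono norm_bounded\<close>)
    also have "\<dots> \<le> L * (exp (\<beta> * \<bar>s\<bar>) * norm z) + F * exp (\<beta> * \<bar>s\<bar>)"
      using F \<beta> by (simp add: mult_le_cancel_left1)
    finally show ?thesis by (simp add: algebra_simps)
  qed
  define T where "T z t = exp (- (\<beta> * \<bar>t\<bar>)) *\<^sub>R (x0 + I z t)" for z t
  have Tmem: "T z \<in> bcontfun" for z
  proof (rule bcontfun_normI)
    show "continuous_on UNIV (T z)"
      unfolding T_def by (intro continuous_intros contI)
    fix t
    have "norm (T z t) \<le> exp (- (\<beta> * \<bar>t\<bar>)) * (norm x0 + (L * norm z + F) / \<beta> * exp (\<beta> * \<bar>t\<bar>))"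
      unfolding T_def I_def
      using oriented_integral_exp_bound[OF gint gb \<beta>]
      by (auto intro!: mult_left_mono norm_triangle_le)
    also have "\<dots> \<le> norm x0 + (L * norm z + F) / \<beta>"
      using \<beta> by (simp add: exp_minus field_simps mult_le_cancel_left1)
    finally show "norm (T z t) \<le> norm x0 + (L * norm z + F) / \<beta>" .
  qed
  have contr: "dist (Bcontfun (T z)) (Bcontfun (T z')) \<le> 1/2 * dist z z'" for z z'
  proof (rule dist_bound)
    fix t
    have d: "(\<lambda>s. g z s - g z' s) integrable_on {a..b}" for a b
      by (intro integrable_diff gint)
    have b: "norm (g z s - g z' s) \<le> (L * dist z z') * exp (\<beta> * \<bar>s\<bar>)" for s
    proof -
      have "g z s - g z' s = M s (exp (\<beta> * \<bar>s\<bar>) *\<^sub>R (apply_bcontfun z s - apply_bcontfun z' s))"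
        by (simp add: g_def linear_diff[OF lin] scaleR_diff_right)
      then have "norm (g z s - g z' s) \<le> L * (exp (\<beta> * \<bar>s\<bar>) * dist (apply_bcontfun z s) (apply_bcontfun z' s))"
        using Mb[of s "exp (\<beta> * \<bar>s\<bar>) *\<^sub>R (apply_bcontfun z s - apply_bcontfun z' s)"] by (simp add: dist_norm)
      also have "\<dots> \<le> L * (exp (\<beta> * \<bar>s\<bar>) * dist z z')"
        using L by (intro mult_left_mono dist_bounded) auto
      finally show ?thesis by (simp add: algebra_simps)
    qed
    have "I z t - I z' t = integral {0..t} (\<lambda>s. g z s - g z' s) - integral {t..0} (\<lambda>s. g z s - g z' s)"
      unfolding I_def by (simp add: integral_diff gint algebra_simps)
    then have "norm (I z t - I z' t) \<le> L * dist z z' / \<beta> * exp (\<beta> * \<bar>t\<bar>)"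
      using oriented_integral_exp_bound[OF d b \<beta>] by simp
    moreover have "T z t - T z' t = exp (- (\<beta> * \<bar>t\<bar>)) *\<^sub>R (I z t - I z' t)"
      by (simp add: T_def algebra_simps)
    ultimately have "norm (T z t - T z' t) \<le> exp (- (\<beta> * \<bar>t\<bar>)) * (L * dist z z' / \<beta> * exp (\<beta> * \<bar>t\<bar>))"
      by (metis exp_ge_zero mult_left_mono norm_scaleR abs_exp_cancel)
    also have "\<dots> = 1/2 * dist z z'"
      using L by (simp add: \<beta>_def exp_minus field_simps)
    finally show "dist (apply_bcontfun (Bcontfun (T z)) t) (apply_bcontfun (Bcontfun (T z')) t) \<le> 1/2 * dist z z'"
      by (simp add: Bcontfun_inverse Tmem dist_norm)
  qed
  obtain z where z: "Bcontfun (T z) = z"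
    using banach_fix_type[of "1/2" "\<lambda>z. Bcontfun (T z)"] contr by auto
  define y where "y t = x0 + I z t" for t
  have y: "exp (\<beta> * \<bar>t\<bar>) *\<^sub>R apply_bcontfun z t = y t" for t
  proof -
    have "apply_bcontfun z t = T z t"
      using z Bcontfun_inverse[OF Tmem, of z] by simp
    then show ?thesis by (simp add: T_def y_def exp_minus)
  qed
  have "y 0 = x0" by (simp add: y_def I_def)
  moreover have "continuous_on UNIV y"
    unfolding y_def by (intro continuous_intros contI)
  moreover have "((\<lambda>s. M s (y s) + f s) has_integral (y b - y a)) {a..b}" if "a \<le> b" for a b
    using I[OF that, of z] by (simp add: g_def[abs_def] y) (simp add: y_def)
  ultimately show ?thesis by blast
qed

section \<open>Solutions of the control system\<close>

lemma bounded_bilinear_matrix_vector_mult: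
  "bounded_bilinear (\<lambda>(M::real^'n^'m) (x::real^'n). M *v x)"
  unfolding bilinear_conv_bounded_bilinear[symmetric] bilinear_def
  by (auto intro!: linearI simp: matrix_vector_mult_add_rdistrib matrix_vector_right_distrib
      matrix_vector_mult_scaleR scaleR_matrix_vector_assoc)

lemma continuous_on_matrix_vector_mult [continuous_intros]:
  fixes f :: "'a::topological_space \<Rightarrow> real^'n^'m"
  shows "continuous_on S f \<Longrightarrow> continuous_on S g \<Longrightarrow> continuous_on S (\<lambda>x. f x *v g x)"
  by (rule bounded_bilinear.continuous_on[OF bounded_bilinear_matrix_vector_mult])

section \<open>Shifts and concatenations of controls\<close>

definition shift :: "real \<Rightarrow> (real \<Rightarrow> 'a) \<Rightarrow> real \<Rightarrow> 'a" where
  "shift t u = (\<lambda>s. u (t + s))"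

text \<open>The second control is restarted: its own time 0 is the switching time. Negative
  switching times occur as well, to replace a control in the past.\<close>

definition concat_at :: "real \<Rightarrow> (real \<Rightarrow> 'a) \<Rightarrow> (real \<Rightarrow> 'a) \<Rightarrow> real \<Rightarrow> 'a" where
  "concat_at t u v = (\<lambda>s. if s < t then u s else v (s - t))"

lemma shift_shift [simp]: "shift s (shift t u) = shift (t + s) u"
  by (simp add: shift_def add.assoc)

lemma shift_0 [simp]: "shift 0 u = u"
  by (simp add: shift_def)

lemma shift_in_controls: 
  assumes "u \<in> controls \<Omega>" shows "shift t u \<in> controls \<Omega>"
  using assms by (auto simp: controls_def shift_def)

lemma concat_at_in_controls: 
  assumes "u \<in> controls \<Omega>" "v \<in> controls \<Omega>" shows "concat_at t u v \<in> controls \<Omega>"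
proof -
  have [measurable]: "u \<in> borel_measurable borel" "v \<in> borel_measurable borel"
    using assms by (auto simp: controls_def)
  show ?thesis using assms unfolding controls_def concat_at_def by auto
qed

lemma const_in_controls: "v \<in> \<Omega> \<Longrightarrow> (\<lambda>_. v) \<in> controls \<Omega>"
  by (auto simp: controls_def)

locale bilinear_system =
  fixes A :: "real^'n^'n" and B :: "'m::finite \<Rightarrow> real^'n^'n" and \<Omega> :: "(real^'m) set"
  assumes compact_range: "compact \<Omega>"
begin

lemma continuous_on_Au [continuous_intros]:
  "continuous_on S f \<Longrightarrow> continuous_on S (\<lambda>x. Au A B (f x))"
  unfolding Au_def by (intro continuous_intros)

lemma ex_growth: "\<exists>L>0. \<forall>v\<in>\<Omega>. \<forall>z. norm (Au A B v *v z) \<le> L * norm z"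
proof -
  obtain K where K: "K \<ge> 0" "\<And>M x. norm ((M::real^'n^'n) *v x) \<le> norm M * norm x * K"
    using bounded_bilinear.nonneg_bounded[OF bounded_bilinear_matrix_vector_mult] by blast
  have "bounded (Au A B ` \<Omega>)"
    by (intro compact_imp_bounded compact_continuous_image compact_range continuous_intros)
  then obtain R where R: "\<And>v. v \<in> \<Omega> \<Longrightarrow> norm (Au A B v) \<le> R"
    by (auto simp: bounded_iff)
  have "norm (Au A B v *v z) \<le> (\<bar>R\<bar> * K + 1) * norm z" if "v \<in> \<Omega>" for v z
  proof -
    have "norm (Au A B v *v z) \<le> norm (Au A B v) * norm z * K" by (rule K)
    also have "\<dots> \<le> \<bar>R\<bar> * norm z * K"
      using R[OF that] K(1) by (intro mult_right_mono) auto
    also have "\<dots> \<le> (\<bar>R\<bar> * K + 1) * norm z"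
      by (simp add: algebra_simps)
    finally show ?thesis .
  qed
  moreover have "\<bar>R\<bar> * K + 1 > 0" using K(1) by (simp add: add_nonneg_pos)
  ultimately show ?thesis by blast
qed

definition growth :: real where
  "growth = (SOME L. L > 0 \<and> (\<forall>v\<in>\<Omega>. \<forall>z. norm (Au A B v *v z) \<le> L * norm z))"

lemma growth_pos: "growth > 0"
  and growth: "v \<in> \<Omega> \<Longrightarrow> norm (Au A B v *v z) \<le> growth * norm z"
  using someI_ex[OF ex_growth] unfolding growth_def by auto

lemma forcing_bounded: "\<exists>F\<ge>0. \<forall>v\<in>\<Omega>. norm (C *v v + d) \<le> F"
proof -
  have "bounded ((\<lambda>v. C *v v + d) ` \<Omega>)"
    by (intro compact_imp_bounded compact_continuous_image compact_range continuous_intros)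
  then obtain R where "\<And>v. v \<in> \<Omega> \<Longrightarrow> norm (C *v v + d) \<le> R"
    by (auto simp: bounded_iff)
  then show ?thesis by (intro exI[of _ "\<bar>R\<bar>"]) fastforce
qed

lemma sol_exists:
  assumes u: "u \<in> controls \<Omega>"
  shows "\<exists>y. y 0 = x \<and> continuous_on UNIV y \<and>
    (\<forall>a b. a \<le> b \<longrightarrow> ((\<lambda>s. Au A B (u s) *v y s + C *v u s + d) has_integral (y b - y a)) {a..b})"
proof -
  obtain F where F: "F \<ge> 0" "\<And>v. v \<in> \<Omega> \<Longrightarrow> norm (C *v v + d) \<le> F"
    using forcing_bounded by blast
  have u\<Omega>: "u s \<in> \<Omega>" for s using u by (simp add: controls_def)
  have "\<exists>y. y 0 = x \<and> continuous_on UNIV y \<and>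
    (\<forall>a b. a \<le> b \<longrightarrow> ((\<lambda>s. Au A B (u s) *v y s + (C *v u s + d)) has_integral (y b - y a)) {a..b})"
  proof (rule linear_ode_exists[OF _ growth F(2) growth_pos])
    fix y :: "real \<Rightarrow> real^'n" and a b :: real
    assume y: "continuous_on UNIV y"
    have m: "(\<lambda>s. Au A B (u s) *v y s + (C *v u s + d)) \<in> borel_measurable borel"
    proof (rule borel_measurable_continuous_Pair[where H = "\<lambda>v z. Au A B v *v z + (C *v v + d)"])
      show "u \<in> borel_measurable borel" using u by (simp add: controls_def)
      show "y \<in> borel_measurable borel" using y by (rule borel_measurable_continuous_onI)
    qed (intro continuous_intros)
    show "(\<lambda>s. Au A B (u s) *v y s + (C *v u s + d)) integrable_on {a..b}"
    proof (rule measurable_bounded_by_integrable_imp_integrable)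
      show "(\<lambda>s. Au A B (u s) *v y s + (C *v u s + d)) \<in> borel_measurable (lebesgue_on {a..b})"
        using m by (intro measurable_restrict_space1 measurable_completion) simp
      show "(\<lambda>s. growth * norm (y s) + F) integrable_on {a..b}"
        by (intro integrable_continuous_interval continuous_intros continuous_on_subset[OF y]) auto
      show "norm (Au A B (u s) *v y s + (C *v u s + d)) \<le> growth * norm (y s) + F" for s
        by (intro norm_triangle_le add_mono growth F u\<Omega>)
    qed auto
  qed (auto intro: u\<Omega> matrix_vector_mul_linear)
  then show ?thesis by (simp add: add.assoc)
qed

text \<open>A solution is a constant plus or minus an indefinite integral. Uniqueness, and with it
  the definite description in \<open>phi\<close>, concerns arbitrary functions satisfying
  \<open>is_sol\<close>, so continuity has to be derived before the growth estimates apply.\<close>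

lemma is_sol_continuous:
  assumes "is_sol A B C d u x y"
  shows "continuous_on {0..T} y" "continuous_on {T..0} y"
proof -
  define G where "G = (\<lambda>s. Au A B (u s) *v y s + C *v u s + d)"
  have p: "(G has_integral (y t - x)) {0..t}" if "t \<ge> 0" for t
    using assms that by (auto simp: is_sol_def G_def)
  have n: "(G has_integral (x - y t)) {t..0}" if "t \<le> 0" for t
    using assms that by (auto simp: is_sol_def G_def)
  show "continuous_on {0..T} y"
  proof (cases "0 \<le> T")
    case True
    have "continuous_on {0..T} (\<lambda>t. x + integral {0..t} G)"
      by (intro continuous_intros indefinite_integral_continuous_1 has_integral_integrable[OF p[OF True]])
    then show ?thesis
      by (rule continuous_on_eq) (use integral_unique[OF p] in auto)
  qed auto
  show "continuous_on {T..0} y"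
  proof (cases "T \<le> 0")
    case True
    have "continuous_on {T..0} (\<lambda>t. x - integral {t..0} G)"
      by (intro continuous_intros indefinite_integral_continuous_1' has_integral_integrable[OF n[OF True]])
    then show ?thesis
      by (rule continuous_on_eq) (use integral_unique[OF n] in auto)
  qed auto
qed

text \<open>The controls need only agree in the open interval between \<open>0\<close> and \<open>t\<close>, so that the lemma
  applies to concatenations without regard to their values at the switching times.\<close>

lemma sol_diff_bound:
  assumes sol: "is_sol A B C d u x y" "is_sol A B C d u' x' y'" and u: "u \<in> controls \<Omega>"
    and agree: "\<And>s. 0 < s \<and> s < t \<or> t < s \<and> s < 0 \<Longrightarrow> u s = u' s"
  shows "norm (y t - y' t) \<le> 2 * norm (x - x') * exp (2 * growth * \<bar>t\<bar>)"
proof -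
  define H where "H u y = (\<lambda>s. Au A B (u s) *v y s + C *v u s + d)" for u :: "real \<Rightarrow> real^'m" and y :: "real \<Rightarrow> real^'n"
  \<comment> \<open>At 0 and \<open>t\<close> the controls may differ; setting the integrand to zero
    there changes no integral and makes the growth bound hold everywhere.\<close>
  define G where "G s = (if s \<in> {0, t} then 0 else H u y s - H u' y' s)" for s
  have G: "norm (G s) \<le> growth * norm (y s - y' s) + 0" if "0 \<le> s \<and> s \<le> t \<or> t \<le> s \<and> s \<le> 0" for s
  proof (cases "s \<in> {0, t}")
    case True
    then show ?thesis using growth_pos by (auto simp: G_def)
  next
    case False
    then have "u s = u' s" using that agree[of s] by auto
    then have "G s = Au A B (u s) *v (y s - y' s)"
      using False by (auto simp: G_def H_def matrix_vector_mult_diff_distrib)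
    then show ?thesis using growth[of "u s" "y s - y' s"] u by (simp add: controls_def)
  qed
  have int: "(G has_integral I - J) S" if "(H u y has_integral I) S" "(H u' y' has_integral J) S" for I J S
    by (rule has_integral_spike_finite[OF _ _ has_integral_diff[OF that], of "{0, t}"]) (auto simp: G_def)
  have y0: "y 0 = x" "y' 0 = x'" using sol by (auto simp: is_sol_def)
  show ?thesis
  proof (cases "0 \<le> t")
    case True
    have "norm (y t - y' t) \<le> 2 * (norm (y 0 - y' 0) + 0 * t) * exp (2 * growth * t)"
    proof (rule linear_growth_forward[where G = G])
      show "continuous_on {0..t} (\<lambda>t. y t - y' t)"
        by (intro continuous_intros is_sol_continuous[OF sol(1)] is_sol_continuous[OF sol(2)])
      fix s assume "s \<in> {0..t}"
      then have "(G has_integral (y s - x) - (y' s - x')) {0..s}"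
        using sol by (intro int) (auto simp: is_sol_def H_def)
      then show "(G has_integral y s - y' s - (y 0 - y' 0)) {0..s}"
        by (simp add: y0 algebra_simps)
    qed (use True G growth_pos in auto)
    then show ?thesis using True by (simp add: y0)
  next
    case False
    have "norm (y t - y' t) \<le> 2 * (norm (y 0 - y' 0) + 0 * \<bar>t\<bar>) * exp (2 * growth * \<bar>t\<bar>)"
    proof (rule linear_growth_backward[where G = G])
      show "continuous_on {t..0} (\<lambda>t. y t - y' t)"
        by (intro continuous_intros is_sol_continuous[OF sol(1)] is_sol_continuous[OF sol(2)])
      fix s assume "s \<in> {t..0}"
      then have "(G has_integral (x - y s) - (x' - y' s)) {s..0}"
        using sol by (intro int) (auto simp: is_sol_def H_def)
      then show "(G has_integral y 0 - y' 0 - (y s - y' s)) {s..0}"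
        by (simp add: y0 algebra_simps)
    qed (use False G growth_pos in auto)
    then show ?thesis by (simp add: y0)
  qed
qed

lemma is_sol_unique:
  assumes "is_sol A B C d u x y" "is_sol A B C d u x y'" "u \<in> controls \<Omega>"
  shows "y = y'"
  using sol_diff_bound[OF assms(1,2,3)] by (intro ext) auto

lemma phi_eqI:
  assumes "is_sol A B C d u x y" "u \<in> controls \<Omega>"
  shows "phi A B C d t x u = y t"
proof -
  have "(THE y. is_sol A B C d u x y) = y"
    using assms by (intro the_equality is_sol_unique)
  then show ?thesis by (simp add: phi_def)
qed

lemma
  assumes u: "u \<in> controls \<Omega>"
  shows phi_0 [simp]: "phi A B C d 0 x u = x"
    and continuous_on_phi: "continuous_on S (\<lambda>t. phi A B C d t x u)"
    and phi_has_integral: "a \<le> b \<Longrightarrow> ((\<lambda>s. Au A B (u s) *v phi A B C d s x u + C *v u s + d)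
      has_integral (phi A B C d b x u - phi A B C d a x u)) {a..b}"
    and is_sol_phi: "is_sol A B C d u x (\<lambda>t. phi A B C d t x u)"
proof -
  obtain y where y: "y 0 = x" "continuous_on UNIV y"
    "\<And>a b. a \<le> b \<Longrightarrow> ((\<lambda>s. Au A B (u s) *v y s + C *v u s + d) has_integral (y b - y a)) {a..b}"
    using sol_exists[OF u] by blast
  have sol: "is_sol A B C d u x y"
    using y(1) y(3)[of 0] y(3)[of _ 0] by (auto simp: is_sol_def)
  have eq: "(\<lambda>t. phi A B C d t x u) = y"
    using phi_eqI[OF sol u] by auto
  show "phi A B C d 0 x u = x" "continuous_on S (\<lambda>t. phi A B C d t x u)"
    "is_sol A B C d u x (\<lambda>t. phi A B C d t x u)"
    using sol y fun_cong[OF eq] by (auto simp: eq intro: continuous_on_subset)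
  show "((\<lambda>s. Au A B (u s) *v phi A B C d s x u + C *v u s + d)
      has_integral (phi A B C d b x u - phi A B C d a x u)) {a..b}" if "a \<le> b"
    using y(3)[OF that] fun_cong[OF eq] by simp
qed

lemma phi_shift:
  assumes u: "u \<in> controls \<Omega>"
  shows "phi A B C d (t + s) x u = phi A B C d s (phi A B C d t x u) (shift t u)"
proof -
  define y where "y = (\<lambda>s. phi A B C d (t + s) x u)"
  have int: "((\<lambda>s. Au A B (shift t u s) *v y s + C *v shift t u s + d) has_integral y b - y a) {a..b}" if "a \<le> b" for a b
    using phi_has_integral[OF u, where a = "a + t" and b = "b + t"] that
    by (simp add: has_integral_shift_Icc_real[symmetric] y_def shift_def o_def add.commute)
  have "y 0 = phi A B C d t x u" by (simp add: y_def)
  then have "is_sol A B C d (shift t u) (phi A B C d t x u) y"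
    unfolding is_sol_def using int[of 0] int[of _ 0] by simp
  from phi_eqI[OF this shift_in_controls[OF u]] show ?thesis by (simp add: y_def)
qed

lemma phi_causal:
  assumes "u \<in> controls \<Omega>" "u' \<in> controls \<Omega>"
    and "\<And>s. 0 < s \<and> s < t \<or> t < s \<and> s < 0 \<Longrightarrow> u s = u' s"
  shows "phi A B C d t x u = phi A B C d t x u'"
proof -
  have "norm (phi A B C d t x u - phi A B C d t x u') \<le> 2 * norm (x - x) * exp (2 * growth * \<bar>t\<bar>)"
    by (rule sol_diff_bound[OF is_sol_phi[OF assms(1)] is_sol_phi[OF assms(2)] assms(1)]) (use assms(3) in auto)
  then show ?thesis by simp
qed

lemma phi_lipschitz:
  assumes "u \<in> controls \<Omega>"
  shows "norm (phi A B C d t x u - phi A B C d t y u) \<le> 2 * norm (x - y) * exp (2 * growth * \<bar>t\<bar>)"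
  using sol_diff_bound[OF is_sol_phi[OF assms] is_sol_phi[OF assms] assms] by auto

text \<open>One superposition principle from which linearity of the homogeneous flow, the formula
  for differences and the splitting into homogeneous flow and forcing all follow by
  specialisation.\<close>

lemma phi_hom_affine:
  assumes u: "u \<in> controls \<Omega>"
  shows "phi A B C d t (x + a *\<^sub>R z) u = phi A B C d t x u + a *\<^sub>R phi_hom A B t z u"
proof (rule phi_eqI[OF _ u])
  define H where "H = (\<lambda>s. Au A B (u s) *v phi A B C d s x u + C *v u s + d)"
  define H0 where "H0 = (\<lambda>s. Au A B (u s) *v phi_hom A B s z u)"
  have eq: "Au A B (u s) *v (phi A B C d s x u + a *\<^sub>R phi_hom A B s z u) + C *v u s + d = H s + a *\<^sub>R H0 s" for s
    by (simp add: H_def H0_def algebra_simps matrix_vector_right_distrib matrix_vector_mult_scaleR)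
  have 1: "is_sol A B C d u x (\<lambda>t. phi A B C d t x u)" by (rule is_sol_phi[OF u])
  have 2: "is_sol A B 0 0 u z (\<lambda>t. phi_hom A B t z u)"
    unfolding phi_hom_def by (rule is_sol_phi[OF u])
  have "(H has_integral (phi A B C d t x u - x)) {0..t}" "(H0 has_integral (phi_hom A B t z u - z)) {0..t}" if "0 \<le> t" for t
    using 1 2 that by (auto simp: is_sol_def H_def H0_def)
  then have p: "((\<lambda>s. H s + a *\<^sub>R H0 s) has_integral (phi A B C d t x u - x) + a *\<^sub>R (phi_hom A B t z u - z)) {0..t}" if "0 \<le> t" for t
    using that by (intro has_integral_add has_integral_cmul)
  have "(H has_integral (x - phi A B C d t x u)) {t..0}" "(H0 has_integral (z - phi_hom A B t z u)) {t..0}" if "t \<le> 0" for t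
    using 1 2 that by (auto simp: is_sol_def H_def H0_def)
  then have n: "((\<lambda>s. H s + a *\<^sub>R H0 s) has_integral (x - phi A B C d t x u) + a *\<^sub>R (z - phi_hom A B t z u)) {t..0}" if "t \<le> 0" for t
    using that by (intro has_integral_add has_integral_cmul)
  show "is_sol A B C d u (x + a *\<^sub>R z) (\<lambda>t. phi A B C d t x u + a *\<^sub>R phi_hom A B t z u)"
    unfolding is_sol_def eq
    using p n by (auto simp: u phi_hom_def algebra_simps)
qed

lemma linear_phi_hom:
  assumes u: "u \<in> controls \<Omega>"
  shows "linear (\<lambda>x. phi_hom A B t x u)"
proof -
  have aff: "phi_hom A B t (x + a *\<^sub>R z) u = phi_hom A B t x u + a *\<^sub>R phi_hom A B t z u" for x a z
    using phi_hom_affine[OF u, of 0 0 t x a z] by (simp add: phi_hom_def)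
  have 0: "phi_hom A B t 0 u = 0"
    using aff[of 0 1 0] by simp
  show ?thesis
    using aff[of _ 1] aff[of 0] 0 by (auto intro!: linearI)
qed

lemma phi_diff:
  assumes u: "u \<in> controls \<Omega>"
  shows "phi A B C d t x u - phi A B C d t y u = phi_hom A B t (x - y) u"
  using phi_hom_affine[OF u, of C d t y 1 "x - y"] by simp

lemma phi_split:
  assumes u: "u \<in> controls \<Omega>"
  shows "phi A B C d t x u = phi_hom A B t x u + phi A B C d t 0 u"
  using phi_hom_affine[OF u, of C d t 0 1 x] by simp

lemma phi_hom_shift:
  assumes u: "u \<in> controls \<Omega>"
  shows "phi_hom A B (t + s) x u = phi_hom A B s (phi_hom A B t x u) (shift t u)"
  unfolding phi_hom_def by (rule phi_shift[OF u])

lemma phi_hom_0 [simp]: "u \<in> controls \<Omega> \<Longrightarrow> phi_hom A B 0 x u = x"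
  unfolding phi_hom_def by simp

lemma phi_hom_bound:
  assumes "u \<in> controls \<Omega>"
  shows "norm (phi_hom A B t x u) \<le> 2 * norm x * exp (2 * growth * \<bar>t\<bar>)"
  using phi_lipschitz[OF assms, of 0 0 t x 0] linear_0[OF linear_phi_hom[OF assms]]
  by (simp add: phi_hom_def)

lemma phi_zero_bound:
  "\<exists>F\<ge>0. \<forall>u\<in>controls \<Omega>. \<forall>t\<ge>0. norm (phi A B C d t 0 u) \<le> 2 * F * t * exp (2 * growth * t)"
proof -
  obtain F where F: "F \<ge> 0" "\<And>v. v \<in> \<Omega> \<Longrightarrow> norm (C *v v + d) \<le> F"
    using forcing_bounded by blast
  have "norm (phi A B C d t 0 u) \<le> 2 * F * t * exp (2 * growth * t)" if u: "u \<in> controls \<Omega>" and t: "t \<ge> 0" for u t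
  proof -
    have "norm (phi A B C d t 0 u) \<le> 2 * (norm (phi A B C d 0 0 u) + F * t) * exp (2 * growth * t)"
    proof (rule linear_growth_forward[where G = "\<lambda>s. Au A B (u s) *v phi A B C d s 0 u + (C *v u s + d)"])
      fix s
      have "u s \<in> \<Omega>" using u by (simp add: controls_def)
      then show "norm (Au A B (u s) *v phi A B C d s 0 u + (C *v u s + d)) \<le> growth * norm (phi A B C d s 0 u) + F"
        by (intro norm_triangle_le add_mono growth F)
    qed (use t F growth_pos continuous_on_phi[OF u] phi_has_integral[OF u, where a = 0] in \<open>auto simp: add.assoc\<close>)
    then show ?thesis using u by simp
  qed
  with F(1) show ?thesis by blast
qed

lemma phi_concat:
  assumes "u \<in> controls \<Omega>" "v \<in> controls \<Omega>" "0 \<le> t" "0 \<le> s"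
  shows "phi A B C d (t + s) x (concat_at t u v) = phi A B C d s (phi A B C d t x u) v"
proof -
  have c: "concat_at t u v \<in> controls \<Omega>" using assms by (intro concat_at_in_controls)
  have "phi A B C d (t + s) x (concat_at t u v) = phi A B C d s (phi A B C d t x (concat_at t u v)) (shift t (concat_at t u v))"
    by (rule phi_shift[OF c])
  also have "phi A B C d t x (concat_at t u v) = phi A B C d t x u"
    using assms c by (intro phi_causal) (auto simp: concat_at_def)
  also have "phi A B C d s (phi A B C d t x u) (shift t (concat_at t u v)) = phi A B C d s (phi A B C d t x u) v"
    using assms c by (intro phi_causal shift_in_controls) (auto simp: concat_at_def shift_def)
  finally show ?thesis .
qed

lemma reach_refl: "\<Omega> \<noteq> {} \<Longrightarrow> x \<in> reach_plus A B C d \<Omega> x"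
proof -
  assume "\<Omega> \<noteq> {}"
  then obtain v where "v \<in> \<Omega>" by blast
  then have v: "(\<lambda>_. v) \<in> controls \<Omega>" by (rule const_in_controls)
  have "x = phi A B C d 0 x (\<lambda>_. v)" by (simp add: phi_0[OF v])
  then show ?thesis unfolding reach_plus_def using v by blast
qed

lemma reach_trans:
  assumes "y \<in> reach_plus A B C d \<Omega> x" "z \<in> reach_plus A B C d \<Omega> y"
  shows "z \<in> reach_plus A B C d \<Omega> x"
proof -
  from assms obtain t u s v where "y = phi A B C d t x u" "0 \<le> t" "u \<in> controls \<Omega>"
    "z = phi A B C d s y v" "0 \<le> s" "v \<in> controls \<Omega>"
    unfolding reach_plus_def by blast
  then have "z = phi A B C d (t + s) x (concat_at t u v)" "0 \<le> t + s" "concat_at t u v \<in> controls \<Omega>"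
    by (auto simp: phi_concat concat_at_in_controls)
  then show ?thesis unfolding reach_plus_def by blast
qed

lemma continuous_on_phi_space:
  assumes "u \<in> controls \<Omega>"
  shows "continuous_on S (\<lambda>x. phi A B C d t x u)"
proof -
  have "continuous_on S (\<lambda>x. phi_hom A B t x u)"
    using linear_phi_hom[OF assms] by (intro linear_continuous_on) (simp add: linear_conv_bounded_linear)
  then show ?thesis
    by (subst phi_split[OF assms]) (intro continuous_intros)
qed

end

section \<open>Bounded solutions of uniformly hyperbolic systems\<close>

locale hyperbolic_system = bilinear_system A B \<Omega>
  for A :: "real^'n^'n" and B :: "'m::finite \<Rightarrow> real^'n^'n" and \<Omega> :: "(real^'m) set" +
  fixes E1 E2 :: "(real \<Rightarrow> real^'m) \<Rightarrow> (real^'n) set" and \<alpha> K :: real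
  assumes \<alpha>: "\<alpha> > 0" and K: "K \<ge> 1"
    and decomp: "u \<in> controls \<Omega> \<Longrightarrow> \<exists>x1\<in>E1 u. \<exists>x2\<in>E2 u. x = x1 + x2"
    and inv1: "u \<in> controls \<Omega> \<Longrightarrow> x \<in> E1 u \<Longrightarrow> phi_hom A B t x u \<in> E1 (shift t u)"
    and inv2: "u \<in> controls \<Omega> \<Longrightarrow> x \<in> E2 u \<Longrightarrow> phi_hom A B t x u \<in> E2 (shift t u)"
    and stable: "u \<in> controls \<Omega> \<Longrightarrow> x \<in> E1 u \<Longrightarrow> t \<ge> 0 \<Longrightarrow>
      norm (phi_hom A B t x u) \<le> K * exp (- \<alpha> * t) * norm x"
    and unstable: "u \<in> controls \<Omega> \<Longrightarrow> x \<in> E2 u \<Longrightarrow> t \<le> 0 \<Longrightarrow>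
      norm (phi_hom A B t x u) \<le> K * exp (\<alpha> * t) * norm x"
begin

lemma phi_hom_back:
  assumes "u \<in> controls \<Omega>"
  shows "phi_hom A B (- t) (phi_hom A B t x u) (shift t u) = x"
  using phi_hom_shift[OF assms, of t "- t" x] assms by simp

text \<open>The two bundles separate exponentially while differences grow at most like
  \<open>exp (2 * growth * t)\<close>; this bounds the angle between the fibres from below uniformly in the
  control, without any appeal to weak-* compactness.\<close>

lemma projections_bounded:
  "\<exists>\<kappa>>0. \<forall>u\<in>controls \<Omega>. \<forall>x1\<in>E1 u. \<forall>x2\<in>E2 u. norm x1 \<le> \<kappa> * norm (x1 + x2) \<and> norm x2 \<le> \<kappa> * norm (x1 + x2)"
proof -
  \<comment> \<open>The decay of \<open>x1\<close> up to time \<open>t\<close> and the return of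
    \<open>x2\<close> from time \<open>t\<close> each contribute
    \<open>K * exp (- \<alpha> * t)\<close>. One of the two exponentials turns
    \<open>K\<^sup>2\<close> into 1/2, the other is bounded by 1.\<close>
  define t where "t = ln (2 * K\<^sup>2) / \<alpha>"
  have K2: "K\<^sup>2 \<ge> 1" using K by (simp add: one_le_power)
  have t0: "t \<ge> 0" unfolding t_def using \<alpha> K2 by (intro divide_nonneg_pos ln_ge_zero) auto
  have et: "K\<^sup>2 * exp (- \<alpha> * t) = 1 / 2"
  proof -
    have "0 < 2 * K\<^sup>2" using K2 by linarith
    moreover have "- \<alpha> * t = - ln (2 * K\<^sup>2)" using \<alpha> by (simp add: t_def)
    ultimately have "exp (- \<alpha> * t) = inverse (2 * K\<^sup>2)"
      by (simp only: exp_minus exp_ln)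
    then show ?thesis using K by (simp add: field_simps)
  qed
  define c where "c = K * exp (- \<alpha> * t) * (2 * exp (2 * growth * t))"
  have c0: "c \<ge> 0" unfolding c_def using K by (intro mult_nonneg_nonneg) auto
  have b: "norm x1 \<le> (2 * c + 2) * norm (x1 + x2) \<and> norm x2 \<le> (2 * c + 2) * norm (x1 + x2)"
    if u: "u \<in> controls \<Omega>" and x1: "x1 \<in> E1 u" and x2: "x2 \<in> E2 u" for u x1 x2
  proof -
    let ?x = "x1 + x2"
    have "norm x2 = norm (phi_hom A B (- t) (phi_hom A B t x2 u) (shift t u))"
      by (simp add: phi_hom_back[OF u])
    also have "\<dots> \<le> K * exp (\<alpha> * (- t)) * norm (phi_hom A B t x2 u)"
      using t0 by (intro unstable shift_in_controls u inv2 x2) auto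
    also have "phi_hom A B t x2 u = phi_hom A B t ?x u - phi_hom A B t x1 u"
      using linear_add[OF linear_phi_hom[OF u]] by simp
    also have "norm \<dots> \<le> 2 * norm ?x * exp (2 * growth * t) + K * exp (- \<alpha> * t) * norm x1"
      using phi_hom_bound[OF u, of t ?x] stable[OF u x1 t0] t0
      by (intro norm_triangle_le_diff) auto
    finally have "norm x2 \<le> K * exp (- \<alpha> * t) * (2 * norm ?x * exp (2 * growth * t) + K * exp (- \<alpha> * t) * norm x1)"
      using K by simp
    also have "\<dots> = c * norm ?x + (K\<^sup>2 * exp (- \<alpha> * t)) * exp (- \<alpha> * t) * norm x1"
      by (simp add: c_def algebra_simps power2_eq_square)
    also have "\<dots> \<le> c * norm ?x + 1 / 2 * norm x1"
      unfolding et using \<alpha> t0 by (intro add_mono mult_right_mono) auto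
    finally have *: "norm x2 \<le> c * norm ?x + 1 / 2 * norm x1" .
    have "norm x1 \<le> norm ?x + norm x2"
      using norm_triangle_ineq4[of ?x x2] by simp
    \<comment> \<open>Inserting the bound on \<open>norm x1\<close> into \<open>*\<close> leaves
      half of \<open>norm x2\<close> on the right, which is absorbed on the left.\<close>
    then have 2: "norm x2 \<le> 2 * c * norm ?x + norm ?x"
      using * by linarith
    have 3: "norm x1 \<le> norm ?x + norm x2"
      using norm_triangle_ineq4[of ?x x2] by simp
    have "(2 * c + 2) * norm ?x = 2 * c * norm ?x + 2 * norm ?x" by (simp add: algebra_simps)
    then show ?thesis using 2 3 norm_ge_zero[of ?x] by linarith
  qed
  moreover have "2 * c + 2 > 0" using c0 by simp
  ultimately show ?thesis by blast
qed

definition \<kappa> :: real where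
  "\<kappa> = (SOME \<kappa>. \<kappa> > 0 \<and> (\<forall>u\<in>controls \<Omega>. \<forall>x1\<in>E1 u. \<forall>x2\<in>E2 u.
     norm x1 \<le> \<kappa> * norm (x1 + x2) \<and> norm x2 \<le> \<kappa> * norm (x1 + x2)))"

lemma \<kappa>_pos: "\<kappa> > 0"
  and \<kappa>: "\<And>u x1 x2. u \<in> controls \<Omega> \<Longrightarrow> x1 \<in> E1 u \<Longrightarrow> x2 \<in> E2 u \<Longrightarrow> norm x1 \<le> \<kappa> * norm (x1 + x2)"
      "\<And>u x1 x2. u \<in> controls \<Omega> \<Longrightarrow> x1 \<in> E1 u \<Longrightarrow> x2 \<in> E2 u \<Longrightarrow> norm x2 \<le> \<kappa> * norm (x1 + x2)"
  using someI_ex[OF projections_bounded] unfolding \<kappa>_def by auto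

text \<open>The stable component is estimated from the past end and the unstable one from the future
  end. At these ends both are at most \<open>\<kappa> * R\<close>, and each decays on its way to
  time 0.\<close>

lemma window:
  assumes u: "u \<in> controls \<Omega>" and S: "0 \<le> S" "S \<le> T" "S \<le> T'"
    and R: "norm (phi_hom A B (- T) z u) \<le> R" "norm (phi_hom A B T' z u) \<le> R"
  shows "norm z \<le> 2 * K * \<kappa> * R * exp (- \<alpha> * S)"
proof -
  obtain z1 z2 where z: "z1 \<in> E1 u" "z2 \<in> E2 u" "z = z1 + z2"
    using decomp[OF u] by blast
  have R0: "R \<ge> 0" using R(1) norm_ge_zero order_trans by blast
  have sum: "phi_hom A B t z1 u + phi_hom A B t z2 u = phi_hom A B t z u" for t
    using linear_add[OF linear_phi_hom[OF u]] z(3) by simp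
  have e: "exp (- \<alpha> * T) \<le> exp (- \<alpha> * S)" "exp (- \<alpha> * T') \<le> exp (- \<alpha> * S)"
    using S \<alpha> by auto
  have "norm z1 = norm (phi_hom A B T (phi_hom A B (- T) z1 u) (shift (- T) u))"
    using phi_hom_back[OF u, of "- T" z1] by simp
  also have "\<dots> \<le> K * exp (- \<alpha> * T) * norm (phi_hom A B (- T) z1 u)"
    using S by (intro stable shift_in_controls u inv1 z) auto
  also have "norm (phi_hom A B (- T) z1 u) \<le> \<kappa> * R"
    using \<kappa>(1)[OF shift_in_controls[OF u] inv1[OF u z(1)] inv2[OF u z(2)], of "- T"] R(1) \<kappa>_pos
    unfolding sum by (meson mult_left_mono order_trans less_imp_le)
  also have "K * exp (- \<alpha> * T) * (\<kappa> * R) \<le> K * exp (- \<alpha> * S) * (\<kappa> * R)"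
    using K \<kappa>_pos R0 e by (intro mult_right_mono mult_left_mono) auto
  finally have 1: "norm z1 \<le> K * exp (- \<alpha> * S) * (\<kappa> * R)"
    using K by simp
  have "norm z2 = norm (phi_hom A B (- T') (phi_hom A B T' z2 u) (shift T' u))"
    using phi_hom_back[OF u, of T' z2] by simp
  also have "\<dots> \<le> K * exp (\<alpha> * (- T')) * norm (phi_hom A B T' z2 u)"
    using S by (intro unstable shift_in_controls u inv2 z) auto
  also have "norm (phi_hom A B T' z2 u) \<le> \<kappa> * R"
    using \<kappa>(2)[OF shift_in_controls[OF u] inv1[OF u z(1)] inv2[OF u z(2)], of "T'"] R(2) \<kappa>_pos
    unfolding sum by (meson mult_left_mono order_trans less_imp_le)
  also have "K * exp (\<alpha> * (- T')) * (\<kappa> * R) \<le> K * exp (- \<alpha> * S) * (\<kappa> * R)"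
    using K \<kappa>_pos R0 e by (intro mult_right_mono mult_left_mono) auto
  finally have 2: "norm z2 \<le> K * exp (- \<alpha> * S) * (\<kappa> * R)"
    using K by simp
  have "norm z \<le> norm z1 + norm z2" using z by (simp add: norm_triangle_ineq)
  also have "\<dots> \<le> 2 * K * \<kappa> * R * exp (- \<alpha> * S)"
    using 1 2 by (simp add: algebra_simps)
  finally show ?thesis .
qed

section \<open>Bounded solutions by summation in discrete time\<close>

lemma phi_int_multiple:
  assumes e: "\<And>u. u \<in> controls \<Omega> \<Longrightarrow> phi A B C d h (e u) u = e (shift h u)"
    and u: "u \<in> controls \<Omega>"
  shows "phi A B C d (of_int n * h) (e u) u = e (shift (of_int n * h) u)"
proof -
  have nat: "phi A B C d (real k * h) (e u) u = e (shift (real k * h) u)" if "u \<in> controls \<Omega>" for k u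
  proof (induction k)
    case 0
    then show ?case using that by simp
  next
    case (Suc k)
    have "phi A B C d (real k * h + h) (e u) u = phi A B C d h (e (shift (real k * h) u)) (shift (real k * h) u)"
      by (simp add: phi_shift[OF that] Suc)
    also have "\<dots> = e (shift (real k * h + h) u)"
      by (simp add: e shift_in_controls that)
    finally show ?case by (simp add: algebra_simps)
  qed
  show ?thesis
  proof (cases n)
    case (nonneg k)
    then show ?thesis using nat[OF u, of k] by simp
  next
    case (neg k)
    \<comment> \<open>Negative multiples reduce to positive ones: start at the control shifted back
      by \<open>?s\<close>, flow forward, and reverse.\<close>
    let ?s = "real (Suc k) * h" let ?u = "shift (- ?s) u"
    have u': "?u \<in> controls \<Omega>" by (rule shift_in_controls[OF u])
    have "phi A B C d ?s (e ?u) ?u = e u" using nat[OF u', of "Suc k"] by simp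
    then have "phi A B C d (- ?s) (e u) u = phi A B C d (- ?s) (phi A B C d ?s (e ?u) ?u) (shift ?s ?u)" by simp
    also have "\<dots> = e ?u" using phi_shift[OF u', of C d ?s "- ?s" "e ?u"] u' by simp
    moreover have "of_int n * h = - ?s" by (simp add: neg algebra_simps)
    ultimately show ?thesis by simp
  qed
qed

text \<open>Discrete form of the Green function of an exponential dichotomy: past forcing is
  projected to the stable fibre and carried forward to time 0, future forcing is projected to the
  unstable fibre and carried back. Geometric decay makes both series converge with one bound for all
  controls.\<close>

lemma bounded_solutions:
  fixes C :: "real^'m^'n" and d :: "real^'n"
  assumes h: "h > 0"
  shows "\<exists>e R. \<forall>u\<in>controls \<Omega>. phi A B C d h (e u) u = e (shift h u) \<and> (\<forall>t. norm (phi A B C d t (e u) u) \<le> R)"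
proof -
  obtain F where F: "F \<ge> 0" "\<And>u t. u \<in> controls \<Omega> \<Longrightarrow> t \<ge> 0 \<Longrightarrow>
      norm (phi A B C d t 0 u) \<le> 2 * F * t * exp (2 * growth * t)"
    using phi_zero_bound[of C d] by blast
  define M where "M = 2 * F * h * exp (2 * growth * h)"
  have M0: "M \<ge> 0" using F h by (simp add: M_def)
  define a where "a u = phi A B C d h 0 u" for u
  have a: "norm (a u) \<le> M" if "u \<in> controls \<Omega>" for u
    using F(2)[OF that, of h] h by (simp add: a_def M_def)
  have "\<forall>u x. \<exists>x1 x2. u \<in> controls \<Omega> \<longrightarrow> x1 \<in> E1 u \<and> x2 \<in> E2 u \<and> x = x1 + x2"
    using decomp by blast
  then obtain p1 p2 where p: "\<And>u x. u \<in> controls \<Omega> \<Longrightarrow> p1 u x \<in> E1 u"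
      "\<And>u x. u \<in> controls \<Omega> \<Longrightarrow> p2 u x \<in> E2 u" "\<And>u x. u \<in> controls \<Omega> \<Longrightarrow> x = p1 u x + p2 u x"
    by metis
  have pb: "norm (p1 u x) \<le> \<kappa> * norm x" "norm (p2 u x) \<le> \<kappa> * norm x" if "u \<in> controls \<Omega>" for u x
    using \<kappa>[OF that p(1)[OF that] p(2)[OF that], of x x] p(3)[OF that, of x] by auto
  \<comment> \<open>\<open>a\<close> is the forcing accumulated over one step. Term \<open>k\<close>
    of \<open>f\<close> takes the step ending at \<open>- k * h\<close>, term \<open>k\<close> of
    \<open>g\<close> the step starting at \<open>k * h\<close>. Both are projected at the end of
    their step, hence the additional \<open>h\<close> in \<open>g\<close>.\<close>
  define f where "f u k = phi_hom A B (real k * h) (p1 (shift (- (real k * h)) u) (a (shift (- (real k * h) - h) u))) (shift (- (real k * h)) u)" for u and k :: nat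
  define g where "g u k = phi_hom A B (- (real k * h + h)) (p2 (shift (real k * h + h) u) (a (shift (real k * h) u))) (shift (real k * h + h) u)" for u and k :: nat
  define q where "q = exp (- \<alpha> * h)"
  have q: "0 < q" "q < 1" using \<alpha> h by (auto simp: q_def)
  define c where "c = K * \<kappa> * M"
  have c0: "c \<ge> 0" using K \<kappa>_pos M0 by (simp add: c_def)
  have qk: "exp (- \<alpha> * (real k * h)) = q ^ k" for k
    by (simp add: q_def exp_of_nat_mult[symmetric] algebra_simps)
  have fb: "norm (f u k) \<le> c * q ^ k" if u: "u \<in> controls \<Omega>" for u k
  proof -
    have "norm (f u k) \<le> K * q ^ k * norm (p1 (shift (- (real k * h)) u) (a (shift (- (real k * h) - h) u)))"
      unfolding f_def qk[symmetric]
      using h by (intro stable shift_in_controls u p) auto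
    also have "\<dots> \<le> K * q ^ k * (\<kappa> * M)"
    proof (intro mult_left_mono)
      show "norm (p1 (shift (- (real k * h)) u) (a (shift (- (real k * h) - h) u))) \<le> \<kappa> * M"
        using \<kappa>_pos by (intro order_trans[OF pb(1)] mult_left_mono a shift_in_controls u) auto
    qed (use K q in auto)
    finally show ?thesis by (simp add: c_def algebra_simps)
  qed
  have gb: "norm (g u k) \<le> c * q ^ k" if u: "u \<in> controls \<Omega>" for u k
  proof -
    have "norm (g u k) \<le> K * exp (\<alpha> * (- (real k * h + h))) * norm (p2 (shift (real k * h + h) u) (a (shift (real k * h) u)))"
      unfolding g_def
      using h mult_nonneg_nonneg[of "real k" h] by (intro unstable shift_in_controls u p) linarith
    also have "\<dots> \<le> K * q ^ k * (\<kappa> * M)"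
    proof (intro mult_mono)
      show "norm (p2 (shift (real k * h + h) u) (a (shift (real k * h) u))) \<le> \<kappa> * M"
        using \<kappa>_pos by (intro order_trans[OF pb(2)] mult_left_mono a shift_in_controls u) auto
      show "exp (\<alpha> * - (real k * h + h)) \<le> q ^ k"
        unfolding qk[symmetric] using \<alpha> h by (simp add: algebra_simps)
    qed (use K q in auto)
    finally show ?thesis by (simp add: c_def algebra_simps)
  qed
  have geo: "summable (\<lambda>k. c * q ^ k)" using q by (intro summable_mult summable_geometric) auto
  have sf: "summable (f u)" and sg: "summable (g u)" if "u \<in> controls \<Omega>" for u
    using fb[OF that] gb[OF that] by (auto intro!: summable_comparison_test'[OF geo])
  define e where "e u = suminf (f u) - suminf (g u)" for u
  define R0 where "R0 = 2 * (\<Sum>k. c * q ^ k)"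
  have eb: "norm (e u) \<le> R0" if u: "u \<in> controls \<Omega>" for u
  proof -
    have "norm (suminf (f u)) \<le> (\<Sum>k. c * q ^ k)" "norm (suminf (g u)) \<le> (\<Sum>k. c * q ^ k)"
      using fb[OF u] gb[OF u] by (auto intro!: norm_suminf_le geo)
    then show ?thesis unfolding e_def R0_def
      using norm_triangle_ineq4[of "suminf (f u)" "suminf (g u)"] by linarith
  qed
  have R00: "R0 \<ge> 0" unfolding R0_def using c0 q by (intro mult_nonneg_nonneg suminf_nonneg geo) auto
  have step: "phi A B C d h (e u) u = e (shift h u)" if u: "u \<in> controls \<Omega>" for u
  proof -
    have su: "shift h u \<in> controls \<Omega>" by (rule shift_in_controls[OF u])
    have bl: "bounded_linear (\<lambda>x. phi_hom A B h x u)"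
      using linear_phi_hom[OF u] by (simp add: linear_conv_bounded_linear)
    have F1: "phi_hom A B h (f u k) u = f (shift h u) (Suc k)" for k
    proof -
      let ?w = "shift (- (real k * h)) u"
      have eq: "phi_hom A B h (phi_hom A B (real k * h) x ?w) u = phi_hom A B (real (Suc k) * h) x ?w" for x
        using phi_hom_shift[OF shift_in_controls[OF u, of "- (real k * h)"], of "real k * h" h x]
        by (simp add: algebra_simps)
      have s: "h + (- (real (Suc k) * h) - h) = - (real k * h) - h" "h + - (real (Suc k) * h) = - (real k * h)"
        by (simp_all add: algebra_simps)
      show ?thesis by (simp only: f_def shift_shift s eq)
    qed
    have G1: "phi_hom A B h (g u (Suc k)) u = g (shift h u) k" for k
    proof -
      let ?t = "real (Suc k) * h + h" let ?w = "shift ?t u"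
      have "phi_hom A B h (phi_hom A B (- ?t) x ?w) (shift (- ?t) ?w) = phi_hom A B (- ?t + h) x ?w" for x
        by (rule phi_hom_shift[symmetric]) (rule shift_in_controls[OF u])
      then show ?thesis by (simp add: g_def algebra_simps)
    qed
    have G0: "phi_hom A B h (g u 0) u = p2 (shift h u) (a u)"
      using phi_hom_back[OF su, of "- h"] by (simp add: g_def)
    have F0: "f (shift h u) 0 = p1 (shift h u) (a u)"
      using su by (simp add: f_def)
    have sgu: "summable (\<lambda>k. phi_hom A B h (g u k) u)"
      by (rule bounded_linear.summable[OF bl sg[OF u]])
    \<comment> \<open>The flow raises the index in \<open>f\<close> and lowers it in
      \<open>g\<close>. The two terms left over are the stable and the unstable part of
      \<open>a u\<close>, which together are the forcing that the homogeneous flow omits.\<close>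
    have "phi_hom A B h (e u) u = phi_hom A B h (suminf (f u)) u - phi_hom A B h (suminf (g u)) u"
      unfolding e_def by (rule linear_diff[OF linear_phi_hom[OF u]])
    also have "phi_hom A B h (suminf (f u)) u = (\<Sum>k. f (shift h u) (Suc k))"
      using bounded_linear.suminf[OF bl sf[OF u]] by (simp add: F1)
    also have "\<dots> = suminf (f (shift h u)) - p1 (shift h u) (a u)"
      using suminf_split_head[OF sf[OF su]] by (simp add: F0)
    also have "phi_hom A B h (suminf (g u)) u = (\<Sum>k. phi_hom A B h (g u k) u)"
      by (rule bounded_linear.suminf[OF bl sg[OF u]])
    also have "\<dots> = (\<Sum>k. g (shift h u) k) + p2 (shift h u) (a u)"
      using suminf_split_head[OF sgu] by (simp add: G0 G1)
    finally have "phi_hom A B h (e u) u = e (shift h u) - (p1 (shift h u) (a u) + p2 (shift h u) (a u))"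
      by (simp add: e_def algebra_simps)
    also have "\<dots> = e (shift h u) - a u" using p(3)[OF su, of "a u"] by simp
    finally show ?thesis
      unfolding phi_split[OF u, of C d h "e u"] by (simp add: a_def)
  qed
  define R where "R = 2 * R0 * exp (2 * growth * h) + M"
  have "norm (phi A B C d t (e u) u) \<le> R" if u: "u \<in> controls \<Omega>" for u t
  proof -
    define n where "n = \<lfloor>t / h\<rfloor>"
    define s where "s = t - of_int n * h"
    have "of_int n \<le> t / h" "t / h < of_int n + 1" unfolding n_def by linarith+
    then have s: "0 \<le> s" "s \<le> h" using h by (auto simp: s_def field_simps)
    let ?w = "shift (of_int n * h) u"
    have w: "?w \<in> controls \<Omega>" by (rule shift_in_controls[OF u])
    have "phi A B C d t (e u) u = phi A B C d (of_int n * h + s) (e u) u" by (simp add: s_def)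
    also have "\<dots> = phi A B C d s (e ?w) ?w"
      by (simp only: phi_shift[OF u] phi_int_multiple[OF step u])
    also have "\<dots> = phi_hom A B s (e ?w) ?w + phi A B C d s 0 ?w" by (rule phi_split[OF w])
    finally have "norm (phi A B C d t (e u) u) \<le> norm (phi_hom A B s (e ?w) ?w) + norm (phi A B C d s 0 ?w)"
      by (simp add: norm_triangle_ineq)
    also have "norm (phi_hom A B s (e ?w) ?w) \<le> 2 * R0 * exp (2 * growth * h)"
      using s growth_pos R00 by (intro order_trans[OF phi_hom_bound[OF w]] mult_mono eb w) auto
    also have "norm (phi A B C d s 0 ?w) \<le> M"
      unfolding M_def using s F growth_pos
      by (intro order_trans[OF F(2)[OF w]] mult_mono) auto
    finally show ?thesis by (simp add: R_def)
  qed
  with step show ?thesis by blast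
qed

end

section \<open>Transport of affine vector fields\<close>

type_synonym 'n affine_field = "(real^'n^'n) \<times> (real^'n)"

definition field_at :: "real^'n \<Rightarrow> 'n::finite affine_field \<Rightarrow> real^'n" where
  "field_at x f = fst f *v x + snd f"

lemma linear_field_at: "linear (field_at x)"
  by (auto intro!: linearI simp: field_at_def matrix_vector_mult_add_rdistrib
      scaleR_matrix_vector_assoc[symmetric] scaleR_add_right)

lemma matrix_add_rdistrib: "((M::real^'n^'m) + N) ** P = M ** P + N ** P"
  by (simp add: matrix_matrix_mult_def vec_eq_iff sum.distrib[symmetric] distrib_right)

lemma bilinear_affine_bracket: "bilinear (affine_bracket :: 'n::finite affine_field \<Rightarrow> _)"
proof -
  have "affine_bracket (f + f') g = affine_bracket f g + affine_bracket f' g"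
    "affine_bracket f (g + g') = affine_bracket f g + affine_bracket f g'"
    for f f' g g' :: "'n affine_field"
    by (simp_all add: affine_bracket_def prod_eq_iff matrix_add_ldistrib matrix_add_rdistrib
        matrix_vector_mult_add_rdistrib matrix_vector_right_distrib)
  moreover have "affine_bracket (c *\<^sub>R f) g = c *\<^sub>R affine_bracket f g"
    "affine_bracket f (c *\<^sub>R g) = c *\<^sub>R affine_bracket f g"
    for c and f g :: "'n affine_field"
    by (simp_all add: affine_bracket_def prod_eq_iff matrix_scalar_ac scalar_matrix_assoc[symmetric]
        matrix_vector_mult_scaleR scaleR_matrix_vector_assoc[symmetric] scaleR_diff_right)
  ultimately show ?thesis unfolding bilinear_def by (auto intro!: linearI simp del: split_paired_All)
qed

lemma linear_affine_bracket_left: "linear (\<lambda>Y. affine_bracket Y X)"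
  and linear_affine_bracket_right: "linear (affine_bracket Y)"
  using bilinear_affine_bracket unfolding bilinear_def by blast+

lemma affine_bracket_self [simp]: "affine_bracket X X = 0"
  by (simp add: affine_bracket_def prod_eq_iff)

text \<open>The Jacobi identity, arranged so that bracketing with \<open>affine_bracket f g\<close>
  is a commutator of bracketing with \<open>f\<close> and with \<open>g\<close>. A subspace
  invariant under the latter two is then invariant under the former.\<close>

lemma affine_bracket_jacobi:
  "affine_bracket Z (affine_bracket f g) = affine_bracket (affine_bracket Z f) g - affine_bracket (affine_bracket Z g) f"
proof -
  have sub1: "(M - N) ** P = M ** P - N ** P" and sub2: "P ** (M - N) = P ** M - P ** N" for M N P :: "real^'n^'n"
    using matrix_add_rdistrib[of "M - N" N P] matrix_add_ldistrib[of P "M - N" N] by (auto simp: algebra_simps)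
  show ?thesis
    by (simp add: affine_bracket_def prod_eq_iff sub1 sub2 matrix_mul_assoc matrix_vector_mul_assoc
        matrix_vector_mult_diff_distrib matrix_vector_mult_diff_rdistrib)
qed

section \<open>Flows of constant linear operators\<close>

lemma ode_derivative:
  fixes y :: "real \<Rightarrow> 'a::euclidean_space"
  assumes G: "continuous_on UNIV G" and int: "\<And>a b. a \<le> b \<Longrightarrow> (G has_integral (y b - y a)) {a..b}"
  shows "(y has_vector_derivative G t) (at t)"
proof -
  have "((\<lambda>s. y (t - 1) + integral {t - 1..s} G) has_vector_derivative G t) (at t within {t - 1..t + 1})"
    by (auto intro!: derivative_eq_intros integral_has_vector_derivative continuous_on_subset[OF G])
  then have "(y has_vector_derivative G t) (at t within {t - 1..t + 1})"
  proof (rule has_vector_derivative_transform[rotated 2])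
    fix s assume "s \<in> {t - 1..t + 1}"
    then show "y s = y (t - 1) + integral {t - 1..s} G"
      using integral_unique[OF int[of "t - 1" s]] by simp
  qed auto
  then show ?thesis by (simp add: at_within_Icc_at)
qed

lemma linear_flow_exists:
  fixes T :: "'a::euclidean_space \<Rightarrow> 'a"
  assumes "linear T"
  shows "\<exists>y. y 0 = x \<and> (\<forall>t. (y has_vector_derivative T (y t)) (at t))"
proof -
  have T: "bounded_linear T" using assms by (simp add: linear_conv_bounded_linear)
  have cont: "continuous_on S y \<Longrightarrow> continuous_on S (\<lambda>s. T (y s))" for S and y :: "real \<Rightarrow> 'a"
    by (rule bounded_linear.continuous_on[OF T])
  have b: "norm (T z) \<le> (onorm T + 1) * norm z" for z
    using onorm[OF T, of z] norm_ge_zero[of z] unfolding distrib_right by linarith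
  have "\<exists>y. y 0 = x \<and> continuous_on UNIV y \<and>
    (\<forall>a b::real. a \<le> b \<longrightarrow> ((\<lambda>s. T (y s) + 0) has_integral (y b - y a)) {a..b})"
  proof (rule linear_ode_exists[where M = "\<lambda>_. T" and f = "\<lambda>_. 0" and L = "onorm T + 1" and F = 0])
    show "onorm T + 1 > 0" using onorm_pos_le[OF T] by simp
    fix y :: "real \<Rightarrow> 'a" and a b :: real assume "continuous_on UNIV y"
    then show "(\<lambda>s. T (y s) + 0) integrable_on {a..b}"
      by (intro integrable_continuous_interval continuous_intros cont) (auto intro: continuous_on_subset)
  qed (use assms b in auto)
  then obtain y where y: "y 0 = x" "continuous_on UNIV y"
    and int: "\<forall>a b::real. a \<le> b \<longrightarrow> ((\<lambda>s. T (y s) + 0) has_integral (y b - y a)) {a..b}"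
    by (elim exE conjE)
  have "(y has_vector_derivative T (y t)) (at t)" for t
    by (rule ode_derivative[OF cont[OF y(2)]]) (use int in simp)
  with y(1) show ?thesis by blast
qed

lemma linear_flow_unique:
  fixes T :: "'a::euclidean_space \<Rightarrow> 'a"
  assumes "linear T" and y: "\<And>t. (y has_vector_derivative T (y t)) (at t)"
    and z: "\<And>t. (z has_vector_derivative T (z t)) (at t)" and 0: "y 0 = z 0"
  shows "y t = z t"
proof -
  have T: "bounded_linear T" using assms by (simp add: linear_conv_bounded_linear)
  define w where "w t = y t - z t" for t
  have w': "(w has_vector_derivative T (w t)) (at t)" for t
    unfolding w_def using has_vector_derivative_diff[OF y[of t] z[of t]] by (simp add: linear_diff[OF assms(1)])
  have cont: "continuous_on S w" for S
    using w' by (meson continuous_at_imp_continuous_on has_vector_derivative_continuous)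
  have b: "norm (T z) \<le> (onorm T + 1) * norm z + 0" for z
    using onorm[OF T, of z] norm_ge_zero[of z] unfolding distrib_right by linarith
  have int: "((\<lambda>s. T (w s)) has_integral (w b - w a)) {a..b}" if "a \<le> b" for a b
    using that w' by (intro fundamental_theorem_of_calculus) (auto intro: has_vector_derivative_at_within)
  have pos: "onorm T + 1 > 0" using onorm_pos_le[OF T] by simp
  have "norm (w t) \<le> 2 * (norm (w 0) + 0 * \<bar>t\<bar>) * exp (2 * (onorm T + 1) * \<bar>t\<bar>)"
  proof (cases "0 \<le> t")
    case True
    have "norm (w t) \<le> 2 * (norm (w 0) + 0 * t) * exp (2 * (onorm T + 1) * t)"
      by (rule linear_growth_forward[where G = "\<lambda>s. T (w s)", OF True cont _ b pos]) (use int in auto)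
    then show ?thesis using True by simp
  next
    case False
    show ?thesis
      by (rule linear_growth_backward[where G = "\<lambda>s. T (w s)", OF _ cont _ b pos]) (use int False in auto)
  qed
  then show ?thesis using 0 by (simp add: w_def)
qed

text \<open>\<open>Ad X t\<close> transports affine vector fields along the flow of \<open>X\<close> for time \<open>t\<close>.\<close>

definition Ad :: "'n::finite affine_field \<Rightarrow> real \<Rightarrow> 'n affine_field \<Rightarrow> 'n affine_field" where
  "Ad X t Y = (SOME y. y 0 = Y \<and> (\<forall>t. (y has_vector_derivative affine_bracket (y t) X) (at t))) t"

lemma Ad_0 [simp]: "Ad X 0 Y = Y"
  and Ad_derivative: "((\<lambda>t. Ad X t Y) has_vector_derivative affine_bracket (Ad X t Y) X) (at t)"
  using someI_ex[OF linear_flow_exists[OF linear_affine_bracket_left[of X], of Y]]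
  unfolding Ad_def by auto

lemma Ad_eqI:
  assumes "y 0 = Y" "\<And>t. (y has_vector_derivative affine_bracket (y t) X) (at t)"
  shows "Ad X t Y = y t"
  by (rule linear_flow_unique[OF linear_affine_bracket_left Ad_derivative assms(2)]) (simp add: assms)

lemma linear_Ad: "linear (Ad X t)"
proof (rule linearI)
  show "Ad X t (Y + Z) = Ad X t Y + Ad X t Z" for Y Z
  proof (rule Ad_eqI)
    fix t
    show "((\<lambda>t. Ad X t Y + Ad X t Z) has_vector_derivative affine_bracket (Ad X t Y + Ad X t Z) X) (at t)"
      unfolding linear_add[OF linear_affine_bracket_left]
      by (intro has_vector_derivative_add Ad_derivative)
  qed simp
  show "Ad X t (c *\<^sub>R Y) = c *\<^sub>R Ad X t Y" for c Y
  proof (rule Ad_eqI)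
    fix t
    show "((\<lambda>t. c *\<^sub>R Ad X t Y) has_vector_derivative affine_bracket (c *\<^sub>R Ad X t Y) X) (at t)"
      unfolding linear_cmul[OF linear_affine_bracket_left]
      by (intro bounded_linear.has_vector_derivative[OF bounded_linear_scaleR_right] Ad_derivative)
  qed simp
qed

lemma Ad_self [simp]: "Ad X t X = X"
  by (rule Ad_eqI[where y = "\<lambda>_. X"]) auto

lemma Ad_minus: "Ad X (- t) (Ad X t Y) = Y"
proof -
  have "Ad X s (Ad X t Y) = Ad X (s + t) Y" for s
  proof (rule Ad_eqI)
    fix s
    have "((\<lambda>r. Ad X r Y) \<circ> (\<lambda>s. s + t) has_vector_derivative 1 *\<^sub>R affine_bracket (Ad X (s + t) Y) X) (at s)"
      by (rule vector_diff_chain_at) (auto intro!: derivative_eq_intros Ad_derivative)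
    then show "((\<lambda>s. Ad X (s + t) Y) has_vector_derivative affine_bracket (Ad X (s + t) Y) X) (at s)"
      by (simp add: o_def)
  qed simp
  from this[of "- t"] show ?thesis by simp
qed

lemma inj_Ad: "inj (Ad X t)"
  by (metis Ad_minus injI)

text \<open>The head of the list is the last arc. Prolonging an arc moves the endpoint along the
  field of that arc, carried through all later arcs; the list collects these fields as seen at the
  endpoint.\<close>

fun transported :: "('n::finite affine_field \<times> real) list \<Rightarrow> 'n affine_field list" where
  "transported [] = []"
| "transported ((X, t) # l) = X # map (Ad X t) (transported l)"

text \<open>The induction is strengthened: every generated \<open>f\<close> lies in \<open>Z\<close>
  and bracketing with \<open>f\<close> preserves \<open>Z\<close>. The second half passes through
  brackets by the Jacobi identity.\<close>

lemma lie_gen_subset: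
  assumes Z: "subspace Z" and G: "G \<subseteq> Z" and inv: "\<And>X Y. X \<in> G \<Longrightarrow> Y \<in> Z \<Longrightarrow> affine_bracket Y X \<in> Z"
  shows "lie_gen G \<subseteq> Z"
proof -
  have "f \<in> Z \<and> (\<forall>Y\<in>Z. affine_bracket Y f \<in> Z)" if "f \<in> lie_gen G" for f
    using that
  proof induction
    case (gen f)
    then show ?case using G inv by blast
  next
    case (add f g)
    then show ?case using Z by (auto simp: linear_add[OF linear_affine_bracket_right] subspace_add)
  next
    case (scale f c)
    then show ?case using Z by (auto simp: linear_cmul[OF linear_affine_bracket_right] subspace_scale)
  next
    case (bracket f g)
    then show ?case using Z by (auto simp: affine_bracket_jacobi[of _ f g] subspace_diff)
  qed
  then show ?thesis by blast
qed

text \<open>A list for which the transported fields span a subspace of maximal dimension: appending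
  further arcs cannot enlarge the span, and the intersection of all these maximal spans is then
  invariant under bracketing with the generators.\<close>

lemma universal_list_exists:
  fixes \<X> :: "'n::finite affine_field set"
  assumes ne: "\<X> \<noteq> {}" and G: "G \<subseteq> span \<X>"
  shows "\<exists>l. l \<noteq> [] \<and> set l \<subseteq> \<X> \<times> {0<..} \<and> lie_gen G \<subseteq> span (set (transported l))"
proof -
  define adm where "adm l \<longleftrightarrow> set l \<subseteq> \<X> \<times> {0<..}" for l :: "('n affine_field \<times> real) list"
  define r where "r l = dim (set (transported l))" for l :: "('n affine_field \<times> real) list"
  define S where "S l = span (set (transported l))" for l :: "('n affine_field \<times> real) list"
  have "\<exists>l. adm l \<and> (\<forall>l'. adm l' \<longrightarrow> r l' \<le> r l)"
  proof (rule ex_has_greatest_nat[of adm "[]" r "Suc DIM('n affine_field)"])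
    show "\<forall>l. adm l \<longrightarrow> r l < Suc DIM('n affine_field)"
      unfolding r_def less_Suc_eq_le using dim_subset_UNIV by blast
  qed (simp add: adm_def)
  then obtain l0 where l0: "adm l0" "\<And>l'. adm l' \<Longrightarrow> r l' \<le> r l0" by blast
  define mx where "mx l \<longleftrightarrow> adm l \<and> r l = r l0" for l
  have ext: "X \<in> S l \<and> mx ((X, s) # l) \<and> S ((X, s) # l) = Ad X s ` S l" if "mx l" "X \<in> \<X>" "s > 0" for l X s
  proof -
    have adm: "adm ((X, s) # l)" using that by (auto simp: mx_def adm_def)
    \<comment> \<open>\<open>Ad X s\<close> fixes \<open>X\<close> and is injective, so prepending
      the arc gives the dimension of the old fields together with \<open>X\<close>. Maximality then
      forces \<open>X\<close> into the old span.\<close>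
    have eq: "set (transported ((X, s) # l)) = Ad X s ` (insert X (set (transported l)))"
      by simp
    have "dim (insert X (set (transported l))) = r ((X, s) # l)"
      unfolding r_def eq using linear_Ad inj_Ad by (metis dim_image_eq inj_on_subset top_greatest)
    also have "\<dots> \<le> r l" using l0(2)[OF adm] that by (simp add: mx_def)
    finally have le: "dim (insert X (set (transported l))) \<le> dim (set (transported l))" by (simp add: r_def)
    then have X: "X \<in> S l"
      unfolding S_def by (metis dim_insert not_add_less1 not_less less_add_one)
    have "r ((X, s) # l) = r l"
      using X \<open>dim (insert X (set (transported l))) = r ((X, s) # l)\<close>
      by (simp add: S_def r_def dim_insert)
    moreover have "S ((X, s) # l) = Ad X s ` S l"
      unfolding S_def eq linear_span_image[OF linear_Ad] using X by (simp add: S_def span_redundant)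
    ultimately show ?thesis using X adm that by (auto simp: mx_def)
  qed
  define Z where "Z = (\<Inter>l\<in>{l. mx l}. S l)"
  have mx0: "mx l0" using l0 by (simp add: mx_def)
  have Z: "subspace Z" unfolding Z_def S_def by (intro subspace_Inter) auto
  have XZ: "\<X> \<subseteq> Z" unfolding Z_def using ext[where s = 1] by auto
  \<comment> \<open>Arcs have positive duration, so inverting the identity for the extended list
    gives invariance only for negative transport times; the bracket is therefore recovered as a
    one-sided derivative.\<close>
  have AdZ: "Ad X (- s) Y \<in> Z" if "X \<in> \<X>" "Y \<in> Z" "s > 0" for X Y s
    unfolding Z_def
  proof safe
    fix l assume l: "mx l"
    then have "mx ((X, s) # l)" and eq: "S ((X, s) # l) = Ad X s ` S l" using ext that by auto
    then have "Y \<in> Ad X s ` S l" using that by (auto simp: Z_def)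
    then show "Ad X (- s) Y \<in> S l" by (auto simp: Ad_minus)
  qed
  have brX: "affine_bracket Y X \<in> Z" if "X \<in> \<X>" "Y \<in> Z" for X Y
  proof -
    let ?D = "affine_bracket Y X"
    let ?q = "\<lambda>h. (Ad X h Y - Y - h *\<^sub>R ?D) /\<^sub>R norm h"
    have "((\<lambda>h. Ad X h Y) has_derivative (\<lambda>h. h *\<^sub>R ?D)) (at_left 0)"
      using Ad_derivative[of X Y 0] has_derivative_at_withinI by (fastforce simp: has_vector_derivative_def)
    then have "(?q \<longlongrightarrow> 0) (at_left 0)"
      unfolding has_derivative_at_within by simp
    \<comment> \<open>For negative \<open>h\<close> the quotient \<open>h / |h|\<close> is -1, so
      \<open>?q h - ?D\<close> is the difference quotient of \<open>Ad X h Y\<close> divided by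
      \<open>|h|\<close>. It lies in the closed subspace \<open>Z\<close> and tends to
      \<open>- ?D\<close>.\<close>
    then have "((\<lambda>h. ?q h - ?D) \<longlongrightarrow> 0 - ?D) (at_left 0)"
      by (intro tendsto_intros)
    moreover have "eventually (\<lambda>h. ?q h - ?D \<in> Z) (at_left (0::real))"
    proof (rule eventually_at_leftI[of "-1"])
      fix h :: real assume h: "h \<in> {-1<..<0}"
      then have "?q h - ?D = (Ad X h Y - Y) /\<^sub>R norm h"
        by (simp add: scaleR_diff_right)
      moreover have "Ad X h Y \<in> Z" using AdZ[OF that, of "- h"] h by simp
      ultimately show "?q h - ?D \<in> Z"
        using that Z by (simp only: subspace_scale subspace_diff)
    qed simp
    ultimately have "0 - ?D \<in> Z"
      using closed_subspace[OF Z] by (intro Lim_in_closed_set[of Z _ "at_left 0"]) auto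
    then show ?thesis using subspace_neg[OF Z] by fastforce
  qed
  have "lie_gen G \<subseteq> Z"
  proof (rule lie_gen_subset[OF Z])
    show "G \<subseteq> Z" using G span_minimal[OF XZ Z] by blast
    fix X Y assume X: "X \<in> G" and Y: "Y \<in> Z"
    have "subspace {X. affine_bracket Y X \<in> Z}"
      using Z linear_affine_bracket_right[of Y]
      by (auto simp: subspace_def linear_0 linear_add linear_cmul)
    then have "span \<X> \<subseteq> {X. affine_bracket Y X \<in> Z}"
      using brX Y by (intro span_minimal) blast
    then show "affine_bracket Y X \<in> Z" using X G by blast
  qed
  \<comment> \<open>The additional arc preserves maximality and makes the list nonempty, which later
    yields a positive period.\<close>
  moreover obtain X where X: "X \<in> \<X>" using ne by blast
  ultimately have "lie_gen G \<subseteq> S ((X, 1) # l0)" "mx ((X, 1) # l0)"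
    using ext[OF mx0 X, of 1] by (auto simp: Z_def)
  then show ?thesis unfolding mx_def adm_def S_def by blast
qed

section \<open>Reachable sets of piecewise constant controls\<close>

locale affine_system = bilinear_system A B \<Omega>
  for A :: "real^'n^'n" and B :: "'m::finite \<Rightarrow> real^'n^'n" and \<Omega> :: "(real^'m) set" +
  fixes C :: "real^'m^'n" and d :: "real^'n"
begin

abbreviation \<phi> :: "real \<Rightarrow> real^'n \<Rightarrow> (real \<Rightarrow> real^'m) \<Rightarrow> real^'n" where
  "\<phi> t x u \<equiv> phi A B C d t x u"

abbreviation \<psi> :: "real \<Rightarrow> real^'n \<Rightarrow> (real \<Rightarrow> real^'m) \<Rightarrow> real^'n" where
  "\<psi> t x u \<equiv> phi_hom A B t x u"

abbreviation reach :: "real^'n \<Rightarrow> (real^'n) set" where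
  "reach x \<equiv> reach_plus A B C d \<Omega> x"

definition vfield :: "real^'m \<Rightarrow> 'n affine_field" where
  "vfield v = (Au A B v, C *v v + d)"

lemma phi_const_derivative:
  assumes "v \<in> \<Omega>"
  shows "((\<lambda>t. \<phi> t x (\<lambda>_. v)) has_vector_derivative field_at (\<phi> t x (\<lambda>_. v)) (vfield v)) (at t)"
proof (rule ode_derivative)
  note v = const_in_controls[OF assms]
  show "continuous_on UNIV (\<lambda>t. field_at (\<phi> t x (\<lambda>_. v)) (vfield v))"
    unfolding field_at_def by (intro continuous_intros continuous_on_phi[OF v])
  show "((\<lambda>t. field_at (\<phi> t x (\<lambda>_. v)) (vfield v)) has_integral \<phi> b x (\<lambda>_. v) - \<phi> a x (\<lambda>_. v)) {a..b}" if "a \<le> b" for a b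
    using phi_has_integral[OF v that] by (simp add: field_at_def vfield_def add.assoc)
qed

lemma phi_hom_const_derivative:
  assumes "v \<in> \<Omega>"
  shows "((\<lambda>t. \<psi> t x (\<lambda>_. v)) has_vector_derivative Au A B v *v \<psi> t x (\<lambda>_. v)) (at t)"
proof -
  interpret hom: affine_system A B \<Omega> 0 0 ..
  show ?thesis
    using hom.phi_const_derivative[OF assms] by (simp add: hom.vfield_def field_at_def phi_hom_def)
qed

text \<open>Both sides solve the homogeneous equation with the same initial value. The transported
  field does not involve \<open>z\<close>: this is what makes one list of arcs regular from all
  initial points.\<close>

lemma phi_hom_transport:
  assumes v: "v \<in> \<Omega>"
  shows "\<psi> t (field_at z Y) (\<lambda>_. v) = field_at (\<phi> t z (\<lambda>_. v)) (Ad (vfield v) t Y)"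
proof (rule linear_flow_unique[of "(*v) (Au A B v)"])
  let ?X = "vfield v" let ?z = "\<lambda>t. \<phi> t z (\<lambda>_. v)"
  fix t
  have "((\<lambda>t. fst (Ad ?X t Y)) has_vector_derivative fst (affine_bracket (Ad ?X t Y) ?X)) (at t)"
    "((\<lambda>t. snd (Ad ?X t Y)) has_vector_derivative snd (affine_bracket (Ad ?X t Y) ?X)) (at t)"
    by (intro bounded_linear.has_vector_derivative[OF bounded_linear_fst]
        bounded_linear.has_vector_derivative[OF bounded_linear_snd] Ad_derivative)+
  then have "((\<lambda>t. fst (Ad ?X t Y) *v ?z t + snd (Ad ?X t Y)) has_vector_derivative
      (fst (Ad ?X t Y) *v field_at (?z t) ?X + fst (affine_bracket (Ad ?X t Y) ?X) *v ?z t)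
      + snd (affine_bracket (Ad ?X t Y) ?X)) (at t)"
    by (intro has_vector_derivative_add phi_const_derivative v
        bounded_bilinear.has_vector_derivative[OF bounded_bilinear_matrix_vector_mult])
  also have "(fst (Ad ?X t Y) *v field_at (?z t) ?X + fst (affine_bracket (Ad ?X t Y) ?X) *v ?z t)
      + snd (affine_bracket (Ad ?X t Y) ?X) = Au A B v *v field_at (?z t) (Ad ?X t Y)"
    by (simp add: affine_bracket_def field_at_def vfield_def matrix_vector_mult_diff_rdistrib
        matrix_vector_right_distrib matrix_vector_mul_assoc)
  finally show "((\<lambda>t. field_at (?z t) (Ad ?X t Y)) has_vector_derivative Au A B v *v field_at (?z t) (Ad ?X t Y)) (at t)"
    by (simp add: field_at_def)
qed (use v const_in_controls[OF v] in \<open>auto intro: phi_hom_const_derivative\<close>)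

lemma isCont_phi_joint:
  assumes u: "u \<in> controls \<Omega>"
  shows "isCont (\<lambda>(z, s). \<phi> s z u) (z0, t)"
proof -
  have "((\<lambda>w. \<psi> (snd w) (fst w - z0) u) \<longlongrightarrow> 0) (at (z0, t))"
  proof (rule Lim_null_comparison)
    show "eventually (\<lambda>w. norm (\<psi> (snd w) (fst w - z0) u) \<le> 2 * norm (fst w - z0) * exp (2 * growth * \<bar>snd w\<bar>)) (at (z0, t))"
      by (intro always_eventually allI phi_hom_bound u)
    have "((\<lambda>w. 2 * norm (fst w - z0) * exp (2 * growth * \<bar>snd w\<bar>)) \<longlongrightarrow> 2 * norm (fst (z0, t) - z0) * exp (2 * growth * \<bar>snd (z0, t)\<bar>)) (at (z0, t))"
      by (intro tendsto_intros)
    then show "((\<lambda>w. 2 * norm (fst w - z0) * exp (2 * growth * \<bar>snd w\<bar>)) \<longlongrightarrow> 0) (at (z0, t))" by simp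
  qed
  moreover have "((\<lambda>w. \<phi> (snd w) z0 u) \<longlongrightarrow> \<phi> (snd (z0, t)) z0 u) (at (z0, t))"
  proof (rule continuous_on_tendsto_compose[OF continuous_on_phi[OF u, of UNIV]])
    show "(snd \<longlongrightarrow> snd (z0, t)) (at (z0, t))" by (intro tendsto_intros)
  qed auto
  ultimately have "((\<lambda>w. \<psi> (snd w) (fst w - z0) u + \<phi> (snd w) z0 u) \<longlongrightarrow> 0 + \<phi> t z0 u) (at (z0, t))"
    by (intro tendsto_add) auto
  moreover have "\<psi> s (z - z0) u + \<phi> s z0 u = \<phi> s z u" for s z
    using phi_diff[OF u, of C d s z z0] by (simp add: algebra_simps)
  ultimately show ?thesis by (simp add: isCont_def case_prod_unfold)
qed

lemma phi_const_joint_derivative: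
  assumes v: "v \<in> \<Omega>"
  shows "((\<lambda>(z, s). \<phi> s z (\<lambda>_. v)) has_derivative
    (\<lambda>(dz, ds). \<psi> t dz (\<lambda>_. v) + ds *\<^sub>R field_at (\<phi> t z0 (\<lambda>_. v)) (vfield v))) (at (z0, t))"
proof -
  note u = const_in_controls[OF v]
  let ?f = "\<lambda>z s. blinfun_scaleR_left (field_at (\<phi> s z (\<lambda>_. v)) (vfield v))"
  have "((\<lambda>(z, s). \<phi> s z (\<lambda>_. v)) has_derivative
    (\<lambda>(dz, ds). \<psi> t dz (\<lambda>_. v) + blinfun_apply (?f z0 t) ds)) (at (z0, t) within UNIV \<times> UNIV)"
  \<comment> \<open>The map is affine in the state, so joint continuity is required only of the
    partial derivative in time.\<close>
  proof (rule has_derivative_partialsI)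
    have "((\<lambda>z. \<psi> t z (\<lambda>_. v) + \<phi> t 0 (\<lambda>_. v)) has_derivative (\<lambda>z. \<psi> t z (\<lambda>_. v) + 0)) (at z0)"
      using linear_phi_hom[OF u] 
      by (intro has_derivative_add bounded_linear_imp_has_derivative has_derivative_const)
        (simp add: linear_conv_bounded_linear)
    then show "((\<lambda>z. \<phi> t z (\<lambda>_. v)) has_derivative (\<lambda>z. \<psi> t z (\<lambda>_. v))) (at z0)"
      by (simp add: phi_split[OF u, symmetric])
    show "((\<lambda>s. \<phi> s z (\<lambda>_. v)) has_derivative blinfun_apply (?f z s)) (at s)" for z s
      using phi_const_derivative[OF v, of z s] by (simp add: has_vector_derivative_def)
    have "isCont (\<lambda>w. blinfun_scaleR_left (fst (vfield v) *v (case w of (z, s) \<Rightarrow> \<phi> s z (\<lambda>_. v)) + snd (vfield v))) (z0, t)"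
      by (intro continuous_intros isCont_phi_joint[OF u] bounded_linear.continuous[OF bounded_linear_blinfun_scaleR_left]
          bounded_linear.continuous[OF matrix_vector_mul_bounded_linear])
    then show "continuous (at (z0, t) within UNIV \<times> UNIV) (\<lambda>(z, s). ?f z s)"
      by (simp add: field_at_def case_prod_unfold)
  qed auto
  then show ?thesis by simp
qed

text \<open>The last arc of the list is followed first; \<open>\<xi>\<close> perturbs the switching times.\<close>

fun endpoint :: "((real^'m) \<times> real \<times> (real^'n)) list \<Rightarrow> real^'n \<Rightarrow> real^'n \<Rightarrow> real^'n" where
  "endpoint [] x \<xi> = x"
| "endpoint ((v, t, a) # p) x \<xi> = \<phi> (t + a \<bullet> \<xi>) (endpoint p x \<xi>) (\<lambda>_. v)"

text \<open>The derivative of \<open>endpoint\<close> at 0 in direction \<open>\<xi>\<close>, kept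
  as an affine field before evaluation at the endpoint; in this form it does not depend on the
  initial point.\<close>

fun variation :: "((real^'m) \<times> real \<times> (real^'n)) list \<Rightarrow> real^'n \<Rightarrow> 'n affine_field" where
  "variation [] \<xi> = 0"
| "variation ((v, t, a) # p) \<xi> = (a \<bullet> \<xi>) *\<^sub>R vfield v + Ad (vfield v) t (variation p \<xi>)"

lemma endpoint_derivative:
  assumes "fst ` set p \<subseteq> \<Omega>"
  shows "(endpoint p x has_derivative (\<lambda>\<xi>. field_at (endpoint p x 0) (variation p \<xi>))) (at 0)"
  using assms
proof (induction p)
  case Nil
  then show ?case by (auto simp: linear_0[OF linear_field_at])
next
  case (Cons q p)
  obtain v t a where q: "q = (v, t, a)" by (cases q)
  have v: "v \<in> \<Omega>" and IH: "(endpoint p x has_derivative (\<lambda>\<xi>. field_at (endpoint p x 0) (variation p \<xi>))) (at 0)"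
    using Cons q by auto
  let ?g = "\<lambda>\<xi>. (endpoint p x \<xi>, t + a \<bullet> \<xi>)"
  have "(?g has_derivative (\<lambda>\<xi>. (field_at (endpoint p x 0) (variation p \<xi>), 0 + a \<bullet> \<xi>))) (at 0)"
    by (intro has_derivative_Pair IH has_derivative_add has_derivative_const has_derivative_inner_right has_derivative_ident)
  moreover have "((\<lambda>(z, s). \<phi> s z (\<lambda>_. v)) has_derivative
    (\<lambda>(dz, ds). \<psi> t dz (\<lambda>_. v) + ds *\<^sub>R field_at (\<phi> t (endpoint p x 0) (\<lambda>_. v)) (vfield v))) (at (?g 0))"
    using phi_const_joint_derivative[OF v] by simp
  ultimately have "((\<lambda>(z, s). \<phi> s z (\<lambda>_. v)) \<circ> ?g has_derivative
    (\<lambda>(dz, ds). \<psi> t dz (\<lambda>_. v) + ds *\<^sub>R field_at (\<phi> t (endpoint p x 0) (\<lambda>_. v)) (vfield v)) \<circ>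
    (\<lambda>\<xi>. (field_at (endpoint p x 0) (variation p \<xi>), 0 + a \<bullet> \<xi>))) (at 0)"
    by (rule diff_chain_at)
  moreover have "(\<lambda>(z, s). \<phi> s z (\<lambda>_. v)) \<circ> ?g = endpoint ((v, t, a) # p) x"
    by auto
  moreover have "((\<lambda>(dz, ds). \<psi> t dz (\<lambda>_. v) + ds *\<^sub>R field_at (\<phi> t (endpoint p x 0) (\<lambda>_. v)) (vfield v)) \<circ>
    (\<lambda>\<xi>. (field_at (endpoint p x 0) (variation p \<xi>), 0 + a \<bullet> \<xi>))) =
    (\<lambda>\<xi>. field_at (endpoint ((v, t, a) # p) x 0) (variation ((v, t, a) # p) \<xi>))"
    by (auto simp: phi_hom_transport[OF v] linear_add[OF linear_field_at] linear_cmul[OF linear_field_at])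
  ultimately show ?case unfolding q by (simp only:)
qed

lemma continuous_on_endpoint:
  assumes "fst ` set p \<subseteq> \<Omega>"
  shows "continuous_on S (endpoint p x)"
  using assms
proof (induction p)
  case Nil
  then show ?case by simp
next
  case (Cons q p)
  obtain v t a where q: "q = (v, t, a)" by (cases q)
  have v: "(\<lambda>_. v) \<in> controls \<Omega>" using Cons q by (auto intro: const_in_controls)
  have "continuous_on UNIV (\<lambda>(z, s). \<phi> s z (\<lambda>_. v))"
    using isCont_phi_joint[OF v] by (intro continuous_at_imp_continuous_on) auto
  then have "continuous_on S (\<lambda>\<xi>. case (endpoint p x \<xi>, t + a \<bullet> \<xi>) of (z, s) \<Rightarrow> \<phi> s z (\<lambda>_. v))"
    by (rule continuous_on_compose2) (use Cons in \<open>auto intro!: continuous_intros\<close>)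
  then show ?case by (simp add: q)
qed

lemma endpoint_lipschitz:
  assumes "fst ` set p \<subseteq> \<Omega>"
  shows "\<exists>\<Lambda>\<ge>0. \<forall>\<xi>\<in>cball 0 1. \<forall>y. norm (endpoint p y \<xi> - endpoint p x \<xi>) \<le> \<Lambda> * norm (y - x)"
  using assms
proof (induction p)
  case Nil
  then show ?case by (intro exI[of _ 1]) auto
next
  case (Cons q p)
  obtain v t a where q: "q = (v, t, a)" by (cases q)
  have v: "(\<lambda>_. v) \<in> controls \<Omega>" using Cons q by (auto intro: const_in_controls)
  obtain \<Lambda> where \<Lambda>: "\<Lambda> \<ge> 0" "\<And>\<xi> y. \<xi> \<in> cball 0 1 \<Longrightarrow> norm (endpoint p y \<xi> - endpoint p x \<xi>) \<le> \<Lambda> * norm (y - x)"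
    using Cons by auto
  define c where "c = 2 * exp (2 * growth * (\<bar>t\<bar> + norm a))"
  have "norm (endpoint (q # p) y \<xi> - endpoint (q # p) x \<xi>) \<le> (\<Lambda> * c) * norm (y - x)" if \<xi>: "\<xi> \<in> cball 0 1" for \<xi> y
  proof -
    have "\<bar>a \<bullet> \<xi>\<bar> \<le> norm a * norm \<xi>" by (rule Cauchy_Schwarz_ineq2)
    also have "\<dots> \<le> norm a * 1" using \<xi> by (intro mult_left_mono) auto
    finally have le: "\<bar>t + a \<bullet> \<xi>\<bar> \<le> \<bar>t\<bar> + norm a" by linarith
    have "norm (endpoint (q # p) y \<xi> - endpoint (q # p) x \<xi>)
      \<le> 2 * norm (endpoint p y \<xi> - endpoint p x \<xi>) * exp (2 * growth * \<bar>t + a \<bullet> \<xi>\<bar>)"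
      unfolding q endpoint.simps by (rule phi_lipschitz[OF v])
    also have "\<dots> \<le> 2 * (\<Lambda> * norm (y - x)) * exp (2 * growth * (\<bar>t\<bar> + norm a))"
      using \<Lambda> \<xi> le growth_pos by (intro mult_mono) auto
    finally show ?thesis by (simp add: c_def algebra_simps)
  qed
  moreover have "\<Lambda> * c \<ge> 0" using \<Lambda> by (simp add: c_def)
  ultimately show ?case by blast
qed

lemma endpoint_in_reach:
  assumes "fst ` set p \<subseteq> \<Omega>" "\<Omega> \<noteq> {}" "\<And>v t a. (v, t, a) \<in> set p \<Longrightarrow> 0 \<le> t + a \<bullet> \<xi>"
  shows "endpoint p x \<xi> \<in> reach x"
  using assms
proof (induction p)
  case Nil
  then show ?case by (simp add: reach_refl)
next
  case (Cons q p)
  obtain v t a where q: "q = (v, t, a)" by (cases q)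
  have v: "(\<lambda>_. v) \<in> controls \<Omega>" using Cons q by (auto intro: const_in_controls)
  have "0 \<le> t + a \<bullet> \<xi>" using Cons.prems(3)[of v t a] q by auto
  then have "\<phi> (t + a \<bullet> \<xi>) (endpoint p x \<xi>) (\<lambda>_. v) \<in> reach (endpoint p x \<xi>)"
    unfolding reach_plus_def using v by blast
  moreover have "endpoint p x \<xi> \<in> reach x"
    using Cons by (intro Cons.IH) auto
  ultimately show ?case unfolding q endpoint.simps by (rule reach_trans[rotated])
qed

text \<open>Weights making the derivative the identity turn \<open>endpoint p y \<xi> = w\<close>
  into a fixed point problem for \<open>\<xi> + (w - endpoint p y \<xi>)\<close>, which is small on
  a small ball. Brouwer's theorem needs the derivative at the single point 0 and tolerates a
  perturbed initial point \<open>y\<close>.\<close>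

lemma endpoint_robust:
  assumes p: "fst ` set p \<subseteq> \<Omega>" and ne: "\<Omega> \<noteq> {}" and pos: "\<And>v t a. (v, t, a) \<in> set p \<Longrightarrow> 0 < t"
    and id: "\<And>\<xi>. field_at (endpoint p x 0) (variation p \<xi>) = \<xi>"
  shows "\<exists>\<epsilon>>0. \<forall>y\<in>ball x \<epsilon>. ball (endpoint p x 0) \<epsilon> \<subseteq> reach y"
proof -
  let ?z = "endpoint p x 0"
  have "(endpoint p x has_derivative (\<lambda>\<xi>. \<xi>)) (at 0)"
    using endpoint_derivative[OF p, of x] by (simp add: id)
  then obtain \<rho>1 where \<rho>1: "\<rho>1 > 0" "\<And>\<xi>. norm \<xi> < \<rho>1 \<Longrightarrow> norm (endpoint p x \<xi> - ?z - \<xi>) \<le> 1/4 * norm \<xi>"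
    unfolding has_derivative_at_alt by (auto dest!: spec[of _ "1/4"])
  have "\<exists>\<rho>>0. \<forall>(v, t, a)\<in>set p. \<forall>\<xi>\<in>cball 0 \<rho>. 0 \<le> t + a \<bullet> \<xi>"
    using pos
  proof (induction p)
    case Nil
    then show ?case by (auto intro: exI[of _ 1])
  next
    case (Cons q p)
    obtain v t a where q: "q = (v, t, a)" by (cases q)
    have t: "t > 0" using Cons.prems[of v t a] q by auto
    have "\<exists>\<rho>>0. \<forall>(v, t, a)\<in>set p. \<forall>\<xi>\<in>cball 0 \<rho>. 0 \<le> t + a \<bullet> \<xi>"
      by (rule Cons.IH) (use Cons.prems in auto)
    then obtain \<rho> where \<rho>: "\<rho> > 0" "\<forall>(v, t, a)\<in>set p. \<forall>\<xi>\<in>cball 0 \<rho>. 0 \<le> t + a \<bullet> \<xi>"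
      by blast
    define \<sigma> where "\<sigma> = t / (norm a + 1)"
    have \<sigma>: "\<sigma> > 0" using t by (simp add: \<sigma>_def add_nonneg_pos)
    have "0 \<le> t + a \<bullet> \<xi>" if "norm \<xi> \<le> \<sigma>" for \<xi>
    proof -
      have "\<bar>a \<bullet> \<xi>\<bar> \<le> norm a * norm \<xi>" by (rule Cauchy_Schwarz_ineq2)
      also have "\<dots> \<le> (norm a + 1) * \<sigma>" using that \<sigma> by (intro mult_mono) auto
      also have "\<dots> = t" by (simp add: \<sigma>_def add_nonneg_eq_0_iff)
      finally show ?thesis by linarith
    qed
    then show ?case using \<rho> \<sigma> q by (intro exI[of _ "min \<rho> \<sigma>"]) auto
  qed
  then obtain \<rho>2 where \<rho>2: "\<rho>2 > 0" "\<And>v t a \<xi>. (v, t, a) \<in> set p \<Longrightarrow> norm \<xi> \<le> \<rho>2 \<Longrightarrow> 0 \<le> t + a \<bullet> \<xi>"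
    by fastforce
  obtain \<Lambda> where \<Lambda>: "\<Lambda> \<ge> 0" "\<And>\<xi> y. norm \<xi> \<le> 1 \<Longrightarrow> norm (endpoint p y \<xi> - endpoint p x \<xi>) \<le> \<Lambda> * norm (y - x)"
    using endpoint_lipschitz[OF p, of x] by auto
  define \<rho> where "\<rho> = min 1 (min (\<rho>1 / 2) \<rho>2)"
  have \<rho>: "\<rho> > 0" "\<rho> \<le> 1" "\<rho> < \<rho>1" "\<rho> \<le> \<rho>2" using \<rho>1 \<rho>2 by (auto simp: \<rho>_def)
  \<comment> \<open>Moving the initial point and moving the target then cost at most
    \<open>\<rho> / 4\<close> each, and the derivative error is at most \<open>\<rho> / 4\<close>,
    so the ball of radius \<open>\<rho>\<close> is mapped into itself.\<close>
  define \<epsilon> where "\<epsilon> = min (\<rho> / 4) (\<rho> / (4 * (\<Lambda> + 1)))"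
  have \<epsilon>: "\<epsilon> > 0" using \<rho> \<Lambda> by (simp add: \<epsilon>_def)
  have "w \<in> reach y" if y: "y \<in> ball x \<epsilon>" and w: "w \<in> ball ?z \<epsilon>" for y w
  proof -
    have L: "\<Lambda> * norm (y - x) \<le> \<rho> / 4"
    proof -
      have "\<Lambda> * norm (y - x) \<le> (\<Lambda> + 1) * (\<rho> / (4 * (\<Lambda> + 1)))"
        using y \<Lambda> by (intro mult_mono) (auto simp: \<epsilon>_def dist_norm norm_minus_commute)
      also have "\<dots> = \<rho> / 4" using \<Lambda>(1) by (simp add: field_simps)
      finally show ?thesis .
    qed
    have W: "norm (w - ?z) \<le> \<rho> / 4"
      using w by (auto simp: \<epsilon>_def dist_norm norm_minus_commute)
    obtain \<xi> where \<xi>: "\<xi> \<in> cball 0 \<rho>" "\<xi> + (w - endpoint p y \<xi>) = \<xi>"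
    proof (rule brouwer[of "cball 0 \<rho>" "\<lambda>\<xi>. \<xi> + (w - endpoint p y \<xi>)"])
      show "continuous_on (cball 0 \<rho>) (\<lambda>\<xi>. \<xi> + (w - endpoint p y \<xi>))"
        by (intro continuous_intros continuous_on_endpoint[OF p])
      show "(\<lambda>\<xi>. \<xi> + (w - endpoint p y \<xi>)) \<in> cball 0 \<rho> \<rightarrow> cball 0 \<rho>"
      proof
        fix \<xi> :: "real^'n" assume "\<xi> \<in> cball 0 \<rho>"
        then have n: "norm \<xi> \<le> \<rho>" by simp
        have 1: "norm (endpoint p x \<xi> - ?z - \<xi>) \<le> 1/4 * norm \<xi>" using n \<rho> by (intro \<rho>1(2)) auto
        have 2: "norm (endpoint p y \<xi> - endpoint p x \<xi>) \<le> \<rho> / 4" using \<Lambda>(2)[of \<xi> y] n \<rho> L by auto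
        have "\<xi> + (w - endpoint p y \<xi>) = (w - ?z) - (endpoint p x \<xi> - ?z - \<xi>) - (endpoint p y \<xi> - endpoint p x \<xi>)"
          by simp
        then have "norm (\<xi> + (w - endpoint p y \<xi>)) \<le> norm (w - ?z) + norm (endpoint p x \<xi> - ?z - \<xi>) + norm (endpoint p y \<xi> - endpoint p x \<xi>)"
          by (metis norm_triangle_ineq4 norm_triangle_le_diff add_mono order_refl)
        then show "\<xi> + (w - endpoint p y \<xi>) \<in> cball 0 \<rho>"
          using 1 2 W n \<rho> by simp
      qed
    qed (use \<rho> in auto)
    then have "endpoint p y \<xi> = w" by (simp add: algebra_simps)
    moreover have "endpoint p y \<xi> \<in> reach y"
      using \<xi> \<rho> \<rho>2 by (intro endpoint_in_reach p ne) auto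
    ultimately show ?thesis by simp
  qed
  then show ?thesis using \<epsilon> by blast
qed

text \<open>The weights are found arc by arc from the head. On basis vectors the coefficient of
  \<open>vfield v\<close> is split off from \<open>T\<close> and encoded as inner products with
  \<open>a\<close>; the remainder is carried back by \<open>Ad (vfield v) (- t)\<close> and left to
  the earlier arcs.\<close>

lemma variation_exists:
  assumes "linear T" and "range T \<subseteq> span (set (transported (map (\<lambda>(v, t). (vfield v, t)) l)))"
  shows "\<exists>p. map (\<lambda>(v, t, a). (v, t)) p = l \<and> variation p = T"
  using assms
proof (induction l arbitrary: T)
  case Nil
  then have "T = (\<lambda>_. 0)" by auto
  then show ?case by (intro exI[of _ "[]"]) auto
next
  case (Cons q l)
  obtain v t where q: "q = (v, t)" by (cases q)
  let ?X = "vfield v" let ?W = "set (transported (map (\<lambda>(v, t). (vfield v, t)) l))"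
  have "T b \<in> span (insert ?X (Ad ?X t ` ?W))" for b
    using Cons.prems(2) q by auto
  then have "\<exists>c. T b - c *\<^sub>R ?X \<in> span (Ad ?X t ` ?W)" for b
    by (simp add: span_breakdown_eq)
  then obtain c where c: "\<And>b. T b - c b *\<^sub>R ?X \<in> Ad ?X t ` span ?W"
    unfolding linear_span_image[OF linear_Ad] by metis
  define a where "a = (\<Sum>b\<in>Basis. c b *\<^sub>R b)"
  define T' where "T' \<xi> = Ad ?X (- t) (T \<xi> - (a \<bullet> \<xi>) *\<^sub>R ?X)" for \<xi>
  have linT: "linear (\<lambda>\<xi>. T \<xi> - (a \<bullet> \<xi>) *\<^sub>R ?X)"
    using Cons.prems(1) by (auto intro!: linearI simp: linear_add linear_cmul inner_right_distrib algebra_simps)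
  have sub: "subspace (Ad ?X t ` span ?W)"
    by (intro linear_subspace_image linear_Ad subspace_span)
  have mem: "T \<xi> - (a \<bullet> \<xi>) *\<^sub>R ?X \<in> Ad ?X t ` span ?W" for \<xi>
  proof -
    have ab: "a \<bullet> b = c b" if "b \<in> Basis" for b
      using that by (simp add: a_def inner_sum_left inner_Basis if_distrib cong: if_cong)
    have "T \<xi> - (a \<bullet> \<xi>) *\<^sub>R ?X = (\<Sum>b\<in>Basis. (\<xi> \<bullet> b) *\<^sub>R (T b - (a \<bullet> b) *\<^sub>R ?X))"
      using linear_sum[OF linT, of "\<lambda>b. (\<xi> \<bullet> b) *\<^sub>R b" Basis]
      by (simp only: euclidean_representation linear_cmul[OF linT])
    also have "\<dots> \<in> Ad ?X t ` span ?W"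
      using c ab by (intro subspace_sum[OF sub] subspace_scale[OF sub]) auto
    finally show ?thesis .
  qed
  have "linear T'"
    unfolding T'_def using linear_compose[OF linT linear_Ad] by (simp add: o_def)
  moreover have "range T' \<subseteq> span ?W"
  proof (rule image_subsetI)
    fix \<xi>
    from mem[of \<xi>] show "T' \<xi> \<in> span ?W" by (auto simp: T'_def Ad_minus)
  qed
  ultimately have "\<exists>p. map (\<lambda>(v, t, a). (v, t)) p = l \<and> variation p = T'"
    by (rule Cons.IH)
  then obtain p where p: "map (\<lambda>(v, t, a). (v, t)) p = l" "variation p = T'"
    by (elim exE conjE)
  have AdT: "Ad ?X t (T' \<xi>) = T \<xi> - (a \<bullet> \<xi>) *\<^sub>R ?X" for \<xi>
    using Ad_minus[of ?X "- t"] by (simp add: T'_def)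
  have "map (\<lambda>(v, t, a). (v, t)) ((v, t, a) # p) = q # l"
    using p q by simp
  moreover have "variation ((v, t, a) # p) = T"
    using p AdT by auto
  ultimately show ?case by (intro exI conjI)
qed

section \<open>Regular controls from the Lie algebra rank condition\<close>

lemma list_control_exists:
  assumes "fst ` set p \<subseteq> \<Omega>" "\<Omega> \<noteq> {}" "\<And>v t a. (v, t, a) \<in> set p \<Longrightarrow> 0 < t"
  shows "\<exists>u\<in>controls \<Omega>. \<forall>x. \<phi> (\<Sum>(v, t, a)\<leftarrow>p. t) x u = endpoint p x 0"
  using assms
proof (induction p)
  case Nil
  then show ?case using const_in_controls by fastforce
next
  case (Cons q p)
  obtain v t a where q: "q = (v, t, a)" by (cases q)
  have v: "(\<lambda>_. v) \<in> controls \<Omega>" using Cons q by (auto intro: const_in_controls)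
  have "\<exists>u\<in>controls \<Omega>. \<forall>x. \<phi> (\<Sum>(v, t, a)\<leftarrow>p. t) x u = endpoint p x 0"
    by (rule Cons.IH) (use Cons.prems in auto)
  then obtain u where u: "u \<in> controls \<Omega>" "\<And>x. \<phi> (\<Sum>(v, t, a)\<leftarrow>p. t) x u = endpoint p x 0"
    by blast
  let ?s = "\<Sum>(v, t, a)\<leftarrow>p. t"
  have s: "0 \<le> ?s" using Cons.prems(3) by (intro sum_list_nonneg) force
  have t: "0 \<le> t" using Cons.prems(3)[of v t a] q by auto
  have "\<phi> (?s + t) x (concat_at ?s u (\<lambda>_. v)) = endpoint (q # p) x 0" for x
    using phi_concat[OF u(1) v s t, of C d x] by (simp add: u(2) q)
  moreover have "concat_at ?s u (\<lambda>_. v) \<in> controls \<Omega>" by (intro concat_at_in_controls u v)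
  ultimately show ?case by (intro bexI[of _ "concat_at ?s u (\<lambda>_. v)"]) (auto simp: q add.commute)
qed

text \<open>The control value 0 gives the drift field, and a small multiple of a unit vector gives
  the drift plus the same multiple of a control field.\<close>

lemma generators_in_span:
  assumes "0 \<in> interior \<Omega>"
  shows "insert (A, d) {(B i, column i C) | i. True} \<subseteq> span (vfield ` \<Omega>)"
proof -
  obtain e where e: "e > 0" "cball 0 e \<subseteq> \<Omega>" using assms by (auto simp: mem_interior_cball)
  have 0: "(A, d) = vfield 0" by (simp add: vfield_def Au_def)
  then have A: "(A, d) \<in> span (vfield ` \<Omega>)" using e by (auto intro!: span_base imageI)
  have "(B i, column i C) \<in> span (vfield ` \<Omega>)" for i
  proof -
    have ax: "axis i e = e *\<^sub>R (axis i 1 :: real^'m)" by (simp add: vec_eq_iff axis_def)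
    have "vfield (axis i e) = (A, d) + e *\<^sub>R (B i, column i C)"
    proof -
      have "C *v axis i e = e *\<^sub>R column i C"
        by (simp add: ax matrix_vector_mult_scaleR matrix_vector_mult_basis)
      moreover have "(\<Sum>j\<in>UNIV. (axis i e $ j) *\<^sub>R B j) = e *\<^sub>R B i"
        by (simp add: axis_def if_distrib[of "\<lambda>x. x *\<^sub>R _"] cong: if_cong)
      ultimately show ?thesis by (simp add: vfield_def Au_def)
    qed
    then have "(B i, column i C) = (1 / e) *\<^sub>R (vfield (axis i e) - (A, d))" using e by simp
    moreover have "axis i e \<in> \<Omega>" using e by (auto simp: ax norm_axis_1)
    ultimately show ?thesis by (simp only: span_scale span_diff span_base imageI A)
  qed
  with A show ?thesis by blast
qed

text \<open>The control and \<open>\<tau>\<close> are fixed before \<open>x\<close>. The weights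
  depend on \<open>x\<close>, but they do not affect the unperturbed trajectory at
  \<open>\<xi> = 0\<close>, so the nominal control is the same for all initial points.\<close>

lemma regular_control:
  assumes rank: "lie_rank_condition A B C d" and int: "0 \<in> interior \<Omega>"
  shows "\<exists>\<tau>>0. \<exists>u\<in>controls \<Omega>. \<forall>x. \<exists>\<epsilon>>0. \<forall>y\<in>ball x \<epsilon>. ball (\<phi> \<tau> x u) \<epsilon> \<subseteq> reach y"
proof -
  have ne: "\<Omega> \<noteq> {}" using int by auto
  let ?G = "insert (A, d) {(B i, column i C) | i. True}"
  obtain k where k: "k \<noteq> []" "set k \<subseteq> vfield ` \<Omega> \<times> {0<..}" "lie_gen ?G \<subseteq> span (set (transported k))"
    using universal_list_exists[OF _ generators_in_span[OF int]] ne by blast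
  have "\<exists>l. k = map (\<lambda>(v, t). (vfield v, t)) l \<and> set l \<subseteq> \<Omega> \<times> {0<..}"
    using k(2)
  proof (induction k)
    case Nil
    then show ?case by auto
  next
    case (Cons q k)
    then obtain l where "k = map (\<lambda>(v, t). (vfield v, t)) l" "set l \<subseteq> \<Omega> \<times> {0<..}" by auto
    moreover obtain v t where "q = (vfield v, t)" "v \<in> \<Omega>" "t > 0" using Cons.prems by auto
    ultimately show ?case by (intro exI[of _ "(v, t) # l"]) auto
  qed
  then obtain l where l: "k = map (\<lambda>(v, t). (vfield v, t)) l" "set l \<subseteq> \<Omega> \<times> {0<..}" by blast
  \<comment> \<open>A linear right inverse of evaluation at \<open>z\<close> with values in the span
    of the transported fields: this is the variation that makes the derivative of the endpoint map
    the identity.\<close>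
  have onto: "\<exists>T. linear T \<and> range T \<subseteq> span (set (transported k)) \<and> (\<forall>\<xi>. field_at z (T \<xi>) = \<xi>)" for z
  proof -
    have eq: "{fst f *v z + snd f | f. f \<in> lie_gen ?G} = field_at z ` lie_gen ?G"
      unfolding field_at_def by blast
    have "span (field_at z ` lie_gen ?G) = UNIV"
      using spec[OF rank[unfolded lie_rank_condition_def], of z] unfolding eq .
    moreover have "span (field_at z ` lie_gen ?G) \<subseteq> field_at z ` span (set (transported k))"
      using k(3) by (intro span_minimal image_mono linear_subspace_image linear_field_at subspace_span)
    ultimately have surj: "UNIV \<subseteq> field_at z ` span (set (transported k))" by (simp only:)
    have "\<forall>b. \<exists>Y. Y \<in> span (set (transported k)) \<and> field_at z Y = b"
    proof
      fix b
      from subsetD[OF surj, of b] obtain Y where "b = field_at z Y" "Y \<in> span (set (transported k))"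
        by (meson UNIV_I imageE)
      then show "\<exists>Y. Y \<in> span (set (transported k)) \<and> field_at z Y = b" by (intro exI[of _ Y]) simp
    qed
    from choice[OF this] obtain Y where "\<forall>b. Y b \<in> span (set (transported k)) \<and> field_at z (Y b) = b" ..
    then have Y: "Y b \<in> span (set (transported k))" "field_at z (Y b) = b" for b by simp_all
    define T where "T \<xi> = (\<Sum>b\<in>Basis. (\<xi> \<bullet> b) *\<^sub>R Y b)" for \<xi>
    have "linear T" unfolding T_def
      by (auto intro!: linearI simp: inner_left_distrib scaleR_add_left sum.distrib scaleR_sum_right)
    moreover have "T \<xi> \<in> span (set (transported k))" for \<xi>
      unfolding T_def by (intro span_sum span_scale Y)
    moreover have "field_at z (T \<xi>) = \<xi>" for \<xi>
      unfolding T_def by (simp add: linear_sum[OF linear_field_at] linear_cmul[OF linear_field_at] Y euclidean_representation)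
    ultimately show ?thesis by (intro exI[of _ T]) (simp add: image_subset_iff)
  qed
  define p0 where "p0 = map (\<lambda>(v, t). (v, t, 0 :: real^'n)) l"
  have arcs: "fst ` set p \<subseteq> \<Omega>" "\<And>v t a. (v, t, a) \<in> set p \<Longrightarrow> 0 < t" "endpoint p x 0 = endpoint p0 x 0"
    if "map (\<lambda>(v, t, a). (v, t)) p = l" for p x
  proof -
    have m: "(v, t) \<in> set l" if "(v, t, a) \<in> set p" for v t a
      using that \<open>map (\<lambda>(v, t, a). (v, t)) p = l\<close> by force
    show "fst ` set p \<subseteq> \<Omega>" "\<And>v t a. (v, t, a) \<in> set p \<Longrightarrow> 0 < t" using m l(2) by force+
    have "endpoint p x 0 = endpoint (map (\<lambda>(v, t). (v, t, 0)) (map (\<lambda>(v, t, a). (v, t)) p)) x 0"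
      by (induction p) auto
    then show "endpoint p x 0 = endpoint p0 x 0" using that by (simp add: p0_def)
  qed
  have p0: "map (\<lambda>(v, t, a). (v, t)) p0 = l" by (simp add: p0_def o_def case_prod_unfold)
  let ?\<tau> = "\<Sum>(v, t, a)\<leftarrow>p0. t"
  have "\<exists>u\<in>controls \<Omega>. \<forall>x. \<phi> ?\<tau> x u = endpoint p0 x 0"
    by (rule list_control_exists[OF arcs(1)[OF p0] ne]) (rule arcs(2)[OF p0])
  then obtain u where u: "u \<in> controls \<Omega>" "\<And>x. \<phi> ?\<tau> x u = endpoint p0 x 0"
    by blast
  have \<tau>: "?\<tau> > 0"
  proof -
    have "p0 \<noteq> []" using k(1) l(1) by (auto simp: p0_def)
    then obtain q p' where q: "p0 = q # p'" by (cases p0) auto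
    have "0 \<le> (\<Sum>(v, t, a)\<leftarrow>p'. t)" using arcs(2)[OF p0] q by (intro sum_list_nonneg) force
    moreover have "0 < fst (snd q)" using arcs(2)[OF p0, of "fst q" "fst (snd q)" "snd (snd q)"] q by simp
    ultimately show ?thesis by (simp add: q case_prod_unfold)
  qed
  have "\<exists>\<epsilon>>0. \<forall>y\<in>ball x \<epsilon>. ball (\<phi> ?\<tau> x u) \<epsilon> \<subseteq> reach y" for x
  proof -
    from onto[of "endpoint p0 x 0"] obtain T where T: "linear T" "range T \<subseteq> span (set (transported k))"
      and id: "\<forall>\<xi>. field_at (endpoint p0 x 0) (T \<xi>) = \<xi>" by (elim exE conjE)
    from variation_exists[OF T[unfolded l(1)]] obtain p
      where p: "map (\<lambda>(v, t, a). (v, t)) p = l" "variation p = T" by (elim exE conjE)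
    have "\<exists>\<epsilon>>0. \<forall>y\<in>ball x \<epsilon>. ball (endpoint p x 0) \<epsilon> \<subseteq> reach y"
    proof (rule endpoint_robust[OF arcs(1)[OF p(1)] ne])
      show "0 < t" if "(v, t, a) \<in> set p" for v t a using arcs(2)[OF p(1) that] .
      show "field_at (endpoint p x 0) (variation p \<xi>) = \<xi>" for \<xi>
        using id by (simp add: p(2) arcs(3)[OF p(1)])
    qed
    then show ?thesis by (simp only: arcs(3)[OF p(1)] u(2))
  qed
  with \<tau> u(1) show ?thesis by blast
qed

end

section \<open>The control set\<close>

definition periodic_ext :: "real \<Rightarrow> (real \<Rightarrow> 'a) \<Rightarrow> real \<Rightarrow> 'a" where
  "periodic_ext \<tau> u = (\<lambda>s. u (s - \<tau> * of_int \<lfloor>s / \<tau>\<rfloor>))"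

lemma periodic_ext_in_controls:
  assumes "u \<in> controls \<Omega>" shows "periodic_ext \<tau> u \<in> controls \<Omega>"
proof -
  have [measurable]: "u \<in> borel_measurable borel" using assms by (simp add: controls_def)
  show ?thesis using assms unfolding controls_def periodic_ext_def by auto
qed

lemma shift_periodic_ext:
  assumes "\<tau> > 0" shows "shift (of_int n * \<tau>) (periodic_ext \<tau> u) = periodic_ext \<tau> u"
proof
  fix s
  have "(of_int n * \<tau> + s) / \<tau> = s / \<tau> + of_int n" using assms by (simp add: field_simps)
  then show "shift (of_int n * \<tau>) (periodic_ext \<tau> u) s = periodic_ext \<tau> u s"
    by (simp add: shift_def periodic_ext_def algebra_simps)
qed

lemma periodic_ext_eq:
  assumes "0 < s" "s < \<tau>" shows "periodic_ext \<tau> u s = u s"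
proof -
  have "\<lfloor>s / \<tau>\<rfloor> = 0" using assms by (simp add: floor_eq_iff)
  then show ?thesis by (simp add: periodic_ext_def)
qed

locale hyperbolic_affine_system =
  hyperbolic_system A B \<Omega> E1 E2 \<alpha> K + affine_system A B \<Omega> C d
  for A :: "real^'n^'n" and B :: "'m::finite \<Rightarrow> real^'n^'n" and \<Omega> :: "(real^'m) set"
    and E1 E2 :: "(real \<Rightarrow> real^'m) \<Rightarrow> (real^'n) set" and \<alpha> K :: real
    and C :: "real^'m^'n" and d :: "real^'n"
begin

lemma exp_decay:
  assumes "\<delta> > 0" shows "\<exists>S\<ge>0. c * exp (- \<alpha> * S) < \<delta>"
proof -
  have "((\<lambda>S. c * exp (- \<alpha> * S)) \<longlongrightarrow> c * 0) at_top"
    using \<alpha> by (intro tendsto_intros filterlim_compose[OF exp_at_bot])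
      (simp add: filterlim_uminus_at_bot filterlim_tendsto_pos_mult_at_top[OF tendsto_const _ filterlim_ident])
  then have "eventually (\<lambda>S. c * exp (- \<alpha> * S) < \<delta>) at_top"
    using assms by (intro order_tendstoD) auto
  then have "eventually (\<lambda>S. c * exp (- \<alpha> * S) < \<delta> \<and> 0 \<le> S) at_top"
    using eventually_ge_at_top[of 0] by eventually_elim auto
  then show ?thesis by (auto simp: eventually_at_top_linorder)
qed

lemma window_phi:
  assumes u: "u \<in> controls \<Omega>" and S: "0 \<le> S" "S \<le> T" "S \<le> T'"
    and "norm (\<phi> (- T) x u) \<le> R1" "norm (\<phi> T' x u) \<le> R1" "norm (\<phi> (- T) y u) \<le> R2" "norm (\<phi> T' y u) \<le> R2"
  shows "norm (x - y) \<le> 2 * K * \<kappa> * (R1 + R2) * exp (- \<alpha> * S)"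
proof (rule window[OF u S])
  show "norm (\<psi> (- T) (x - y) u) \<le> R1 + R2" "norm (\<psi> T' (x - y) u) \<le> R1 + R2"
    unfolding phi_diff[OF u, of C d, symmetric]
    using assms norm_triangle_ineq4[of "\<phi> (- T) x u" "\<phi> (- T) y u"]
      norm_triangle_ineq4[of "\<phi> T' x u" "\<phi> T' y u"] by linarith+
qed

lemma phi_reverse:
  assumes "u \<in> controls \<Omega>"
  shows "\<phi> (- t) (\<phi> t x u) (shift t u) = x"
  using phi_shift[OF assms, of C d t "- t" x] assms by simp

lemma reach_later:
  assumes "u \<in> controls \<Omega>" "s \<le> t"
  shows "\<phi> t x u \<in> reach (\<phi> s x u)"
proof -
  have "\<phi> t x u = \<phi> (t - s) (\<phi> s x u) (shift s u)"
    using phi_shift[OF assms(1), of C d s "t - s" x] by simp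
  then show ?thesis unfolding reach_plus_def using assms shift_in_controls by fastforce
qed

lemma reach_closure_trans:
  assumes "y \<in> reach x" shows "closure (reach y) \<subseteq> closure (reach x)"
  using reach_trans[OF assms] by (intro closure_mono) auto

lemma phi_closure_reach:
  assumes "u \<in> controls \<Omega>" "t \<ge> 0" "z \<in> closure (reach x)"
  shows "\<phi> t z u \<in> closure (reach x)"
proof -
  have "(\<lambda>z. \<phi> t z u) ` closure (reach x) \<subseteq> closure (reach x)"
  proof (rule image_closure_subset[OF continuous_on_phi_space[OF assms(1)]])
    have "\<phi> t y u \<in> reach x" if "y \<in> reach x" for y
      using reach_trans[OF that] assms(1,2) unfolding reach_plus_def by blast
    then show "(\<lambda>z. \<phi> t z u) ` reach x \<subseteq> closure (reach x)"
      using closure_subset by fastforce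
  qed simp
  then show ?thesis using assms(3) by blast
qed

end

locale periodic_hyperbolic_system = hyperbolic_affine_system A B \<Omega> E1 E2 \<alpha> K C d
  for A :: "real^'n^'n" and B :: "'m::finite \<Rightarrow> real^'n^'n" and \<Omega> :: "(real^'m) set"
    and E1 E2 :: "(real \<Rightarrow> real^'m) \<Rightarrow> (real^'n) set" and \<alpha> K :: real
    and C :: "real^'m^'n" and d :: "real^'n" +
  fixes e :: "(real \<Rightarrow> real^'m) \<Rightarrow> real^'n" and R \<tau> \<epsilon> :: real and w :: "real \<Rightarrow> real^'m" and r :: "real^'n"
  assumes e_bound: "u \<in> controls \<Omega> \<Longrightarrow> norm (\<phi> t (e u) u) \<le> R"
    and \<tau>: "\<tau> > 0" and w: "w \<in> controls \<Omega>" and w_periodic: "shift (of_int n * \<tau>) w = w"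
    and r_periodic: "\<phi> (of_int n * \<tau>) r w = r" and r_bound: "norm (\<phi> t r w) \<le> R"
    and \<epsilon>: "\<epsilon> > 0" and mutual: "y \<in> ball r \<epsilon> \<Longrightarrow> ball r \<epsilon> \<subseteq> reach y"
begin

text \<open>One direction is approximate, the other exact. The exactness costs nothing, since points
  near \<open>r\<close> reach \<open>r\<close>: approximating \<open>r\<close> already means
  reaching it.\<close>

definition D :: "(real^'n) set" where
  "D = {z \<in> closure (reach r). r \<in> reach z}"

lemma ex_multiple: "\<exists>n::int. of_int n * \<tau> \<ge> S \<and> n \<ge> 0"
proof -
  obtain n :: nat where "S < real n * \<tau>" using reals_Archimedean3[OF \<tau>] by blast
  then show ?thesis by (intro exI[of _ "int n"]) auto
qed

lemma shadow:
  assumes u: "u \<in> controls \<Omega>" and S: "0 \<le> S" "S \<le> T" "S \<le> T'"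
    and "norm (\<phi> (- T) z u) \<le> \<rho>" "norm (\<phi> T' z u) \<le> \<rho>"
  shows "norm (z - e u) \<le> 2 * K * \<kappa> * (\<rho> + R) * exp (- \<alpha> * S)"
  using assms e_bound[OF u] by (intro window_phi[OF u S])

text \<open>The loop from \<open>r\<close> through \<open>z\<close> back to \<open>r\<close> is
  extended on both sides by full periods of \<open>w\<close>. In this long window \<open>z\<close>
  is shadowed by the bounded solution of the extended control, however long the loop itself
  is.\<close>

lemma reach_returning: "norm z \<le> R" if z: "z \<in> reach r" and r: "r \<in> reach z"
proof (rule field_le_epsilon)
  fix \<delta> :: real assume "\<delta> > 0"
  then obtain S where S: "S \<ge> 0" "2 * K * \<kappa> * (R + R) * exp (- \<alpha> * S) < \<delta>"
    using exp_decay by blast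
  obtain n :: int where n: "of_int n * \<tau> \<ge> S" using ex_multiple by blast
  let ?N = "of_int n * \<tau>"
  have N: "?N \<ge> 0" using n S by simp
  obtain t1 u1 where 1: "z = \<phi> t1 r u1" "t1 \<ge> 0" "u1 \<in> controls \<Omega>" using z by (auto simp: reach_plus_def)
  obtain t2 u2 where 2: "r = \<phi> t2 z u2" "t2 \<ge> 0" "u2 \<in> controls \<Omega>" using r by (auto simp: reach_plus_def)
  define c2 where "c2 = concat_at t2 u2 w"
  define c1 where "c1 = concat_at t1 u1 c2"
  define c where "c = concat_at ?N w c1"
  have cc: "c2 \<in> controls \<Omega>" "c1 \<in> controls \<Omega>" "c \<in> controls \<Omega>"
    unfolding c2_def c1_def c_def using 1 2 w by (auto intro!: concat_at_in_controls)
  have a: "\<phi> (?N + s) r c = \<phi> s r c1" if "s \<ge> 0" for s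
    using phi_concat[OF w cc(2) N that, of C d r] by (simp add: c_def r_periodic)
  have b: "\<phi> (t1 + s) r c1 = \<phi> s z c2" if "s \<ge> 0" for s
    using phi_concat[OF 1(3) cc(1) 1(2) that, of C d r] by (simp add: c1_def 1(1))
  have g: "\<phi> (t2 + s) z c2 = \<phi> s r w" if "s \<ge> 0" for s
    using phi_concat[OF 2(3) w 2(2) that, of C d z] 2(1) by (simp add: c2_def)
  have z': "\<phi> (?N + t1) r c = z" using a[OF 1(2)] b[of 0] cc by simp
  have end': "\<phi> (t2 + ?N) z (shift (?N + t1) c) = r"
  proof -
    have "\<phi> (t2 + ?N) z (shift (?N + t1) c) = \<phi> (?N + t1 + (t2 + ?N)) r c"
      using phi_shift[OF cc(3), of C d "?N + t1" "t2 + ?N" r] unfolding z' by (rule sym)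
    also have "\<dots> = \<phi> (?N + (t1 + (t2 + ?N))) r c" by (simp only: add.assoc)
    also have "\<dots> = r" using a[of "t1 + (t2 + ?N)"] b[of "t2 + ?N"] g[OF N] 1(2) 2(2) N by (simp add: r_periodic)
    finally show ?thesis .
  qed
  have start: "\<phi> (- (?N + t1)) z (shift (?N + t1) c) = r"
    using phi_reverse[OF cc(3), of "?N + t1" r] by (simp only: z')
  have r0: "norm r \<le> R" using r_bound[of 0] w by simp
  let ?c = "shift (?N + t1) c"
  have c': "?c \<in> controls \<Omega>" by (rule shift_in_controls[OF cc(3)])
  have "norm (z - e ?c) \<le> 2 * K * \<kappa> * (R + R) * exp (- \<alpha> * S)"
    by (rule shadow[OF c' S(1), of "?N + t1" "t2 + ?N"]) (use n 1 2 start end' r0 in auto)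
  moreover have "norm (e ?c) \<le> R" using e_bound[OF c', of 0] c' by simp
  ultimately show "norm z \<le> R + \<delta>"
    using S(2) norm_triangle_ineq2[of z "e ?c"] by linarith
qed

text \<open>A point of \<open>D\<close> is only a limit of points reached from \<open>r\<close>.
  Lying outside the closed ball and being steered near \<open>r\<close> by the same control are open
  conditions, so a nearby point that is exactly reached would violate the bound for loops.\<close>

lemma D_bounded: "D \<subseteq> cball 0 R"
proof
  fix z assume z: "z \<in> D"
  then obtain t u where u: "r = \<phi> t z u" "t \<ge> 0" "u \<in> controls \<Omega>"
    by (auto simp: D_def reach_plus_def)
  show "z \<in> cball 0 R"
  proof (rule ccontr)
    assume "z \<notin> cball 0 R"
    let ?O = "{y. \<phi> t y u \<in> ball r \<epsilon>} \<inter> - cball 0 R"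
    have "open ((\<lambda>y. \<phi> t y u) -` ball r \<epsilon>)"
      using continuous_on_phi_space[OF u(3), of UNIV] by (intro open_vimage) auto
    then have "open ?O" by (intro open_Int) (auto simp: vimage_def)
    moreover have "z \<in> ?O" using u(1) \<epsilon> \<open>z \<notin> cball 0 R\<close> by auto
    ultimately have "?O \<inter> reach r \<noteq> {}"
      using z open_Int_closure_eq_empty[of ?O "reach r"] by (auto simp: D_def)
    then obtain y where y: "\<phi> t y u \<in> ball r \<epsilon>" "y \<notin> cball 0 R" "y \<in> reach r" by blast
    have "r \<in> reach (\<phi> t y u)" using mutual[OF y(1)] \<epsilon> by auto
    then have "r \<in> reach y" using reach_trans u unfolding reach_plus_def by blast
    then show False using reach_returning[OF y(3)] y(2) by simp
  qed
qed

lemma ball_subset_D: "ball r \<epsilon> \<subseteq> D"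
proof
  fix y assume y: "y \<in> ball r \<epsilon>"
  have "y \<in> reach r" using mutual[of r] y \<epsilon> by auto
  moreover have "r \<in> reach y" using mutual[OF y] \<epsilon> by auto
  ultimately show "y \<in> D" using closure_subset by (auto simp: D_def)
qed

lemma reach_r_if_near:
  assumes "r \<in> closure (reach y)" shows "r \<in> reach y"
proof -
  have "ball r \<epsilon> \<inter> reach y \<noteq> {}"
    using assms \<epsilon> open_Int_closure_eq_empty[of "ball r \<epsilon>" "reach y"] centre_in_ball[of r \<epsilon>] by blast
  then obtain q where "q \<in> ball r \<epsilon>" "q \<in> reach y" by blast
  then show ?thesis using mutual[of q] \<epsilon> reach_trans by (meson centre_in_ball subsetD)
qed

lemma D_cs_props: "cs_props A B C d \<Omega> D"
  unfolding cs_props_def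
proof safe
  fix z assume z: "z \<in> D"
  then obtain t1 u1 where u1: "r = \<phi> t1 z u1" "t1 \<ge> 0" "u1 \<in> controls \<Omega>"
    by (auto simp: D_def reach_plus_def)
  have zc: "z \<in> closure (reach r)" using z by (simp add: D_def)
  \<comment> \<open>The orbit runs to \<open>r\<close> and then stays on the periodic orbit, from
    every point of which \<open>r\<close> is reached again.\<close>
  let ?c = "concat_at t1 u1 w"
  have c: "?c \<in> controls \<Omega>" using u1 w by (intro concat_at_in_controls)
  have "\<phi> t z ?c \<in> D" if t: "t \<ge> 0" for t
  proof (cases "t \<le> t1")
    case True
    have eq: "\<phi> t z ?c = \<phi> t z u1"
      using True t by (intro phi_causal c u1) (auto simp: concat_at_def)
    have "r \<in> reach (\<phi> t z u1)" unfolding u1(1) by (rule reach_later[OF u1(3) True])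
    then show ?thesis unfolding D_def eq using phi_closure_reach[OF u1(3) t zc] by simp
  next
    case False
    let ?s = "t - t1"
    have eq: "\<phi> t z ?c = \<phi> ?s r w"
      using phi_concat[OF u1(3) w u1(2), of ?s C d z] False u1(1) by simp
    obtain n :: int where n: "of_int n * \<tau> \<ge> ?s" using ex_multiple by blast
    have "r \<in> reach (\<phi> ?s r w)"
      using reach_later[OF w n, of r] by (simp add: r_periodic)
    moreover have "\<phi> ?s r w \<in> reach r"
      using reach_later[OF w, of 0 ?s r] False w by simp
    ultimately show ?thesis unfolding D_def eq using closure_subset by auto
  qed
  then show "\<exists>u\<in>controls \<Omega>. \<forall>t\<ge>0. \<phi> t z u \<in> D" using c by blast
next
  fix z y assume "z \<in> D" "y \<in> D"
  then show "y \<in> closure (reach z)"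
    unfolding D_def using reach_closure_trans by blast
qed

lemma r_in_D: "r \<in> D"
  using ball_subset_D \<epsilon> by auto

lemma D_control_set: "control_set A B C d \<Omega> D"
  unfolding control_set_def
proof (intro conjI allI impI)
  show "D \<noteq> {}" using r_in_D by blast
  show "cs_props A B C d \<Omega> D" by (rule D_cs_props)
  fix D' assume D': "D \<subseteq> D' \<and> cs_props A B C d \<Omega> D'"
  then have cl: "\<And>x y. x \<in> D' \<Longrightarrow> y \<in> D' \<Longrightarrow> y \<in> closure (reach x)" and r: "r \<in> D'"
    using r_in_D by (auto simp: cs_props_def)
  have "y \<in> D" if "y \<in> D'" for y
    unfolding D_def using cl[OF r that] reach_r_if_near[OF cl[OF that r]] by simp
  then show "D' = D" using D' by blast
qed

text \<open>A trajectory that starts in a bounded set, returns to a ball around \<open>x0\<close> after a long time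
  and returns once more after another long time is, at the intermediate time, close to the bounded
  solution for any control that coincides with it in between. Replacing the control outside by \<open>w\<close>
  connects the ball with \<open>r\<close> in both directions.\<close>

lemma return_connects:
  assumes u: "u \<in> controls \<Omega>" and S: "S \<ge> 0" "S \<le> T1" "S \<le> T2"
    and b: "norm (\<phi> (- T1) z u) \<le> \<rho>" "norm (\<phi> T2 z u) \<le> \<rho>"
    and z: "z \<in> ball x0 \<delta>" and small: "2 * K * \<kappa> * (\<rho> + R) * exp (- \<alpha> * S) < \<delta>"
  shows "(\<exists>x\<in>ball x0 (2 * \<delta>). r \<in> reach x) \<and> (\<exists>y\<in>ball x0 (2 * \<delta>). y \<in> reach r)"
proof -
  have near: "e a \<in> ball x0 (2 * \<delta>)" if a: "a \<in> controls \<Omega>" and eq: "\<And>s. - T1 < s \<Longrightarrow> s < T2 \<Longrightarrow> a s = u s" for a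
  proof -
    have "\<phi> (- T1) z a = \<phi> (- T1) z u" "\<phi> T2 z a = \<phi> T2 z u"
      using S eq by (auto intro!: phi_causal a u)
    then have "norm (z - e a) \<le> 2 * K * \<kappa> * (\<rho> + R) * exp (- \<alpha> * S)"
      using b by (intro shadow[OF a S]) auto
    then have "dist z (e a) < \<delta>" using small by (simp add: dist_norm)
    moreover have "dist x0 z < \<delta>" using z by simp
    ultimately show ?thesis using dist_triangle[of x0 "e a" z] by simp
  qed
  obtain S' where S': "S' \<ge> 0" "2 * K * \<kappa> * (R + R) * exp (- \<alpha> * S') < \<epsilon>"
    using exp_decay[OF \<epsilon>] by blast
  obtain n :: int where n: "of_int n * \<tau> \<ge> S'" using ex_multiple by blast
  let ?N = "of_int n * \<tau>"
  have N: "?N \<ge> 0" using n S' by simp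
  have wN: "w (?N + s) = w s" "w (s - ?N) = w s" for s
    using fun_cong[OF w_periodic[of n], of s] fun_cong[OF w_periodic[of "- n"], of s]
    by (simp_all add: shift_def)
  \<comment> \<open>For any control agreeing with \<open>w\<close> on a long symmetric window, an
    orbit bounded by \<open>R\<close> is near the periodic one, hence inside the ball where
    \<open>mutual\<close> applies.\<close>
  have close: "q \<in> ball r \<epsilon>" if a: "a \<in> controls \<Omega>" and eq: "\<And>s. - ?N < s \<Longrightarrow> s < ?N \<Longrightarrow> a s = w s"
    and q: "\<And>t. norm (\<phi> t q a) \<le> R" for a q
  proof -
    have "\<phi> (- ?N) r a = \<phi> (- ?N) r w" "\<phi> ?N r a = \<phi> ?N r w"
      using N eq by (auto intro!: phi_causal a w)
    then have "norm (q - r) \<le> 2 * K * \<kappa> * (R + R) * exp (- \<alpha> * S')"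
      using q r_bound n by (intro window_phi[OF a S'(1), of ?N ?N]) auto
    then show ?thesis using S'(2) by (simp add: dist_norm norm_minus_commute)
  qed
  have orbit: "norm (\<phi> t (\<phi> s (e a) a) (shift s a)) \<le> R" if "a \<in> controls \<Omega>" for a s t
    using e_bound[OF that, of "s + t"] by (simp add: phi_shift[OF that])

  \<comment> \<open>\<open>e a\<close> is near \<open>x0\<close> because \<open>a\<close> still
    agrees with \<open>u\<close> around time 0, and its orbit approaches \<open>r\<close> after
    \<open>T2\<close> because \<open>w\<close> has taken over.\<close>
  define a where "a = concat_at T2 u w"
  have a: "a \<in> controls \<Omega>" unfolding a_def by (intro concat_at_in_controls u w)
  have "\<phi> (T2 + ?N) (e a) a \<in> ball r \<epsilon>"
  proof (rule close[OF shift_in_controls[OF a] _ orbit[OF a]])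
    show "shift (T2 + ?N) a s = w s" if "- ?N < s" for s
      using that wN(1)[of s] by (auto simp: shift_def a_def concat_at_def)
  qed
  then have "r \<in> reach (\<phi> (T2 + ?N) (e a) a)" using mutual \<epsilon> by (meson centre_in_ball subsetD)
  moreover have "\<phi> (T2 + ?N) (e a) a \<in> reach (e a)"
    using reach_later[OF a, of 0 "T2 + ?N" "e a"] S N a by simp
  ultimately have 1: "r \<in> reach (e a)" by (rule reach_trans[rotated])
  have "e a \<in> ball x0 (2 * \<delta>)" by (rule near[OF a]) (auto simp: a_def concat_at_def)

  \<comment> \<open>The mirror image in the past. Shifting \<open>w\<close> by \<open>T1\<close>
    puts its time 0 at the switching time, so that going back a further \<open>?N\<close> from there
    meets the phase of \<open>r\<close>.\<close>
  define c where "c = concat_at (- T1) (shift T1 w) (shift (- T1) u)"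
  have c: "c \<in> controls \<Omega>" unfolding c_def by (intro concat_at_in_controls shift_in_controls u w)
  let ?t = "- T1 - ?N"
  have "\<phi> ?t (e c) c \<in> ball r \<epsilon>"
  proof (rule close[OF shift_in_controls[OF c] _ orbit[OF c]])
    show "shift ?t c s = w s" if "s < ?N" for s
      using that wN(2)[of s] by (auto simp: shift_def c_def concat_at_def algebra_simps)
  qed
  then have "\<phi> ?t (e c) c \<in> reach r" using mutual[of r] \<epsilon> by auto
  moreover have "e c \<in> reach (\<phi> ?t (e c) c)"
    using reach_later[OF c, of ?t 0 "e c"] S N c by simp
  ultimately have 2: "e c \<in> reach r" by (rule reach_trans)
  have "e c \<in> ball x0 (2 * \<delta>)" by (rule near[OF c]) (auto simp: c_def concat_at_def shift_def)
  with 1 2 \<open>e a \<in> ball x0 (2 * \<delta>)\<close> show ?thesis by blast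
qed

text \<open>Approximate reachability gives no lower bound on the transfer time. Staying in
  \<open>D'\<close> for time \<open>S\<close> before steering back enforces one.\<close>

lemma cs_props_return:
  assumes D': "cs_props A B C d \<Omega> D'" and x: "x \<in> D'" and ball: "x0 \<in> D'" "\<delta> > 0" and S: "S \<ge> 0"
  shows "\<exists>u\<in>controls \<Omega>. \<exists>T\<ge>S. \<phi> T x u \<in> ball x0 \<delta>"
proof -
  obtain u1 where u1: "u1 \<in> controls \<Omega>" "\<phi> S x u1 \<in> D'"
    using D' x S unfolding cs_props_def by blast
  then have "x0 \<in> closure (reach (\<phi> S x u1))" using D' ball unfolding cs_props_def by blast
  then obtain y where y: "y \<in> reach (\<phi> S x u1)" "dist y x0 < \<delta>"
    using ball(2) by (auto simp: closure_approachable)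
  then obtain s u2 where u2: "y = \<phi> s (\<phi> S x u1) u2" "s \<ge> 0" "u2 \<in> controls \<Omega>"
    by (auto simp: reach_plus_def)
  have "\<phi> (S + s) x (concat_at S u1 u2) \<in> ball x0 \<delta>"
    using y u2 phi_concat[OF u1(1) u2(3) S u2(2), of C d x] by (simp add: dist_commute)
  moreover have "concat_at S u1 u2 \<in> controls \<Omega>" by (intro concat_at_in_controls u1 u2)
  moreover have "S + s \<ge> S" using u2 by simp
  ultimately show ?thesis by blast
qed

lemma D_unique:
  assumes D': "control_set A B C d \<Omega> D'" and int: "interior D' \<noteq> {}"
  shows "D' = D"
proof -
  have cs: "cs_props A B C d \<Omega> D'" using D' by (simp add: control_set_def)
  obtain x0 \<eta> where x0: "\<eta> > 0" "ball x0 \<eta> \<subseteq> D'"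
    using int by (auto simp: mem_interior)
  define \<delta> where "\<delta> = \<eta> / 2"
  have \<delta>: "\<delta> > 0" "ball x0 (2 * \<delta>) \<subseteq> D'" using x0 by (auto simp: \<delta>_def)
  have sub: "ball x0 \<delta> \<subseteq> D'" "x0 \<in> D'" using \<delta> by auto
  \<comment> \<open>This bounds \<open>x0\<close> and all points of the ball, hence both ends of the
    double loop. It is fixed before \<open>S\<close>, because the path in between never
    enters.\<close>
  define \<rho> where "\<rho> = norm x0 + \<delta>"
  obtain S where S: "S \<ge> 0" "2 * K * \<kappa> * (\<rho> + R) * exp (- \<alpha> * S) < \<delta>"
    using exp_decay[OF \<delta>(1)] by blast
  obtain u1 T1 where 1: "u1 \<in> controls \<Omega>" "T1 \<ge> S" "\<phi> T1 x0 u1 \<in> ball x0 \<delta>"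
    using cs_props_return[OF cs sub(2) sub(2) \<delta>(1) S(1)] by blast
  let ?z = "\<phi> T1 x0 u1"
  obtain u2 T2 where 2: "u2 \<in> controls \<Omega>" "T2 \<ge> S" "\<phi> T2 ?z u2 \<in> ball x0 \<delta>"
    using cs_props_return[OF cs _ sub(2) \<delta>(1) S(1), of ?z] 1(3) sub(1) by blast
  define c where "c = concat_at T1 u1 u2"
  have c: "c \<in> controls \<Omega>" unfolding c_def by (intro concat_at_in_controls 1 2)
  have pos: "0 \<le> T1" "0 \<le> T2" using S 1 2 by auto
  have zc: "\<phi> T1 x0 c = ?z" using phi_concat[OF 1(1) 2(1) pos(1), of 0 C d x0] 2(1) by (simp add: c_def)
  have "\<phi> T2 ?z (shift T1 c) = \<phi> T2 ?z u2"
    using phi_concat[OF 1(1) 2(1) pos, of C d x0] phi_shift[OF c, of C d T1 T2 x0] by (simp add: c_def[symmetric] zc)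
  moreover have "\<phi> (- T1) ?z (shift T1 c) = x0"
    using phi_reverse[OF c, of T1 x0] by (simp add: zc)
  moreover have "norm y \<le> \<rho>" if "y \<in> ball x0 \<delta>" for y
    using that norm_triangle_ineq2[of y x0] by (simp add: \<rho>_def dist_norm norm_minus_commute)
  ultimately have "(\<exists>x\<in>ball x0 (2 * \<delta>). r \<in> reach x) \<and> (\<exists>y\<in>ball x0 (2 * \<delta>). y \<in> reach r)"
    using 1 2 S \<delta>(1) by (intro return_connects[OF shift_in_controls[OF c, of T1] S(1) 1(2) 2(2) _ _ 1(3) S(2)]) (auto simp: \<rho>_def)
  then obtain x y where x: "x \<in> D'" "r \<in> reach x" and y: "y \<in> D'" "y \<in> reach r"
    using \<delta>(2) by blast
  have cl: "b \<in> closure (reach a)" if "a \<in> D'" "b \<in> D'" for a b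
    using cs that by (auto simp: cs_props_def)
  have "q \<in> D" if q: "q \<in> D'" for q
  proof -
    have "q \<in> closure (reach r)" using cl[OF y(1) q] reach_closure_trans[OF y(2)] by blast
    moreover have "r \<in> closure (reach q)"
    proof -
      obtain t u where u: "r = \<phi> t x u" "t \<ge> 0" "u \<in> controls \<Omega>" using x(2) by (auto simp: reach_plus_def)
      show ?thesis unfolding u(1) by (rule phi_closure_reach[OF u(3,2) cl[OF q x(1)]])
    qed
    ultimately show ?thesis by (simp add: D_def reach_r_if_near)
  qed
  then have "D' \<subseteq> D" by blast
  then show ?thesis using D' D_cs_props unfolding control_set_def by blast
qed

end

section \<open>Choice of the periodic data and conclusion\<close>

context hyperbolic_affine_system
begin

lemma unique_bounded_control_set:
  assumes rank: "lie_rank_condition A B C d" and int: "0 \<in> interior \<Omega>"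
  shows "\<exists>D. control_set A B C d \<Omega> D \<and> interior D \<noteq> {} \<and> bounded D \<and>
           (\<forall>D'. control_set A B C d \<Omega> D' \<and> interior D' \<noteq> {} \<longrightarrow> D' = D)"
proof -
  obtain \<tau> v where \<tau>: "\<tau> > 0" and v: "v \<in> controls \<Omega>"
    and reg: "\<And>x. \<exists>\<epsilon>>0. \<forall>y\<in>ball x \<epsilon>. ball (\<phi> \<tau> x v) \<epsilon> \<subseteq> reach y"
    using regular_control[OF rank int] by blast
  obtain e R where e: "\<And>u. u \<in> controls \<Omega> \<Longrightarrow> \<phi> \<tau> (e u) u = e (shift \<tau> u)"
    and eR: "\<And>u t. u \<in> controls \<Omega> \<Longrightarrow> norm (\<phi> t (e u) u) \<le> R"
    using bounded_solutions[OF \<tau>, of C d] by blast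
  define w where "w = periodic_ext \<tau> v"
  have w: "w \<in> controls \<Omega>" unfolding w_def by (rule periodic_ext_in_controls[OF v])
  have sw: "shift (of_int n * \<tau>) w = w" for n unfolding w_def by (rule shift_periodic_ext[OF \<tau>])
  define r where "r = e w"
  have r: "\<phi> (of_int n * \<tau>) r w = r" for n
    using phi_int_multiple[OF e w, of n] by (simp add: sw r_def)
  \<comment> \<open>\<open>v\<close> and its periodic extension are compared only inside the open
    period, which is enough for the flow. So \<open>v\<close> also returns \<open>r\<close> to
    itself, and the source and target balls of \<open>reg\<close> have the same centre.\<close>
  have "\<phi> \<tau> r v = \<phi> \<tau> r w"
    using \<tau> by (intro phi_causal v w) (auto simp: w_def periodic_ext_eq)
  then have "\<phi> \<tau> r v = r" using r[of 1] by simp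
  then obtain \<epsilon> where \<epsilon>: "\<epsilon> > 0" "\<And>y. y \<in> ball r \<epsilon> \<Longrightarrow> ball r \<epsilon> \<subseteq> reach y"
    using reg[of r] by auto
  interpret periodic_hyperbolic_system A B \<Omega> E1 E2 \<alpha> K C d e R \<tau> \<epsilon> w r
    by unfold_locales (use eR \<tau> w sw r \<epsilon> r_def in auto)
  have "interior D \<noteq> {}"
    using interior_maximal[OF ball_subset_D open_ball] \<epsilon>(1) by force
  moreover have "bounded D" using D_bounded bounded_cball bounded_subset by blast
  ultimately show ?thesis using D_control_set D_unique by blast
qed

end

theorem theorem4p8:
  fixes A :: "real^'n^'n" and B :: "'m::finite \<Rightarrow> real^'n^'n"
    and C :: "real^'m^'n" and d :: "real^'n" and \<Omega> :: "(real^'m) set"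
  assumes "lie_rank_condition A B C d"
    and "compact \<Omega>" and "convex \<Omega>" and "0 \<in> interior \<Omega>"
    and "uniformly_hyperbolic A B \<Omega>"
  shows "\<exists>D. control_set A B C d \<Omega> D \<and> interior D \<noteq> {} \<and> bounded D \<and>
           (\<forall>D'. control_set A B C d \<Omega> D' \<and> interior D' \<noteq> {} \<longrightarrow> D' = D)"
proof -
  from assms(5) obtain V1 V2 \<alpha> K where h: "\<alpha> > 0" "K \<ge> 1"
    and inv: "flow_invariant A B V1" "flow_invariant A B V2"
    and sum: "\<forall>u\<in>controls \<Omega>. fiber V1 u \<inter> fiber V2 u = {0} \<and>
            {x1 + x2 | x1 x2. x1 \<in> fiber V1 u \<and> x2 \<in> fiber V2 u} = UNIV"
    and st: "\<forall>(u, x1)\<in>V1. \<forall>t\<ge>0. norm (phi_hom A B t x1 u) \<le> K * exp (- \<alpha> * t) * norm x1"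
    and un: "\<forall>(u, x2)\<in>V2. \<forall>t\<le>0. norm (phi_hom A B t x2 u) \<le> K * exp (\<alpha> * t) * norm x2"
    unfolding uniformly_hyperbolic_def by (elim exE conjE)
  have inv': "phi_hom A B t x u \<in> fiber V (shift t u)" if "flow_invariant A B V" "x \<in> fiber V u" for V t x u
  proof -
    have "(\<lambda>(u, x). ((\<lambda>s. u (t + s)), phi_hom A B t x u)) ` V = V"
      using that(1) unfolding flow_invariant_def by (rule spec)
    moreover have "(u, x) \<in> V" using that(2) by (simp add: fiber_def)
    ultimately show ?thesis by (force simp: fiber_def shift_def)
  qed
  interpret hyperbolic_affine_system A B \<Omega> "fiber V1" "fiber V2" \<alpha> K C d
  proof unfold_locales
    fix u x assume "u \<in> controls \<Omega>"
    then have "x \<in> {x1 + x2 | x1 x2. x1 \<in> fiber V1 u \<and> x2 \<in> fiber V2 u}"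
      using sum by auto
    then show "\<exists>x1\<in>fiber V1 u. \<exists>x2\<in>fiber V2 u. x = x1 + x2" by blast
  qed (use assms h inv' inv st un in \<open>auto simp: fiber_def\<close>)
  show ?thesis by (rule unique_bounded_control_set[OF assms(1,4)])
qed

end
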